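(* Let $M$ be a monoid, let $k$ be an algebraically closed field (regarded as an $M$-ring with trivial $M$-action) such that $|k| > |M|$, and let $\mathbf{X} = (X_1, \ldots, X_n)$ be a finite tuple of variables. Then, for every subset $F$ of the ring of $M$-polynomials $k[\sigma^m(\mathbf{X}) \mid m \in M]$, we have $$\mathcal{I}(\mathcal{V}(F))=\sqrt{ \langle \sigma^m(F) \mid m \in M \rangle },$$ where $\mathcal{V}(F) = \{ \mathbf{x}\in (k^M)^n \mid f(\mathbf{x})=0 \text{ for all } f\in F\}$ and, for $S\subseteq (k^M)^n$, $\mathcal{I}(S) = \{f\in k[\sigma^m(\mathbf{X}) \mid m \in M] \mid f(\mathbf{x})=0 \text{ for all } \mathbf{x}\in S \}$.
   Context: For a monoid $M$, an $M$-ring is a commutative ring $A$ with an action of $M$ on $A$ by ring endomorphisms; the endomorphism corresponding to $m\in M$ is denoted $\sigma^m$ (so $\sigma^{m_1}\sigma^{m_2}=\sigma^{m_1m_2}$). The ring of sequences $k^M$ is the ring of all maps $M\to k$ with componentwise operations and action $\sigma^m((x_\ell)_{\ell\in M})=(x_{\ell m})_{\ell\in M}$. The field $k$ is mapped into $k^M$ by constant sequences. The ring of $M$-polynomials $k[\sigma^m(\mathbf{X})\mid m\in M]$ is the polynomial ring over $k$ in the indeterminates $\sigma^m(X_i)$ ($m\in M$, $1\le i\le n$), with $M$ acting trivially on $k$ and by $\sigma^{m_1}(\sigma^{m_2}(X_i))=\sigma^{m_1m_2}(X_i)$. For $\mathbf{x}=(x_1,\ldots,x_n)\in(k^M)^n$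 and an $M$-polynomial $f$, $f(\mathbf{x})\in k^M$ is the image of $f$ under the unique morphism of $M$-rings (ring morphism commuting with the $M$-action) $k[\sigma^m(\mathbf{X})\mid m\in M]\to k^M$ that extends $k\to k^M$ and sends $X_i\mapsto x_i$. $\langle\cdot\rangle$ denotes the generated ideal and $\sqrt{\cdot}$ the radical. *)

theory Defs
  imports
    "HOL-Library.Poly_Mapping"
    "HOL-Library.Function_Algebras"
    "HOL-Library.Equipollence"
    "HOL-Computational_Algebra.Polynomial"
begin

section \<open>Rings with an action of a monoid\<close>

definition is_ring_hom :: "('a::comm_ring_1 \<Rightarrow> 'b::comm_ring_1) \<Rightarrow> bool" where
  "is_ring_hom h \<longleftrightarrow>
     h 1 = 1 \<and> (\<forall>a b. h (a + b) = h a + h b) \<and> (\<forall>a b. h (a * b) = h a * h b)"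

definition is_M_ring :: "('m::monoid_mult \<Rightarrow> 'a::comm_ring_1 \<Rightarrow> 'a) \<Rightarrow> bool" where
  "is_M_ring \<sigma> \<longleftrightarrow>
     (\<forall>m. is_ring_hom (\<sigma> m)) \<and> \<sigma> 1 = id \<and> (\<forall>m1 m2. \<sigma> (m1 * m2) = \<sigma> m1 \<circ> \<sigma> m2)"

definition is_M_ring_hom ::
  "('m \<Rightarrow> 'a::comm_ring_1 \<Rightarrow> 'a) \<Rightarrow> ('m \<Rightarrow> 'b::comm_ring_1 \<Rightarrow> 'b) \<Rightarrow> ('a \<Rightarrow> 'b) \<Rightarrow> bool" where
  "is_M_ring_hom \<sigma> \<tau> h \<longleftrightarrow> is_ring_hom h \<and> (\<forall>m a. h (\<sigma> m a) = \<tau> m (h a))"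


section \<open>Ideals and radicals\<close>

text \<open>An ideal of a commutative ring is a submodule of the ring over itself, so the generated
  ideal is the span with respect to multiplication.\<close>

definition ideal_generated :: "'a::comm_ring_1 set \<Rightarrow> 'a set" where
  "ideal_generated S = module.span (*) S"

lemma module_times: "module ((*) :: 'a::comm_ring_1 \<Rightarrow> 'a \<Rightarrow> 'a)"
  by unfold_locales (simp_all add: algebra_simps)

lemma ideal_generated_hull:
  "ideal_generated S =
     (\<lambda>I. 0 \<in> I \<and> (\<forall>a\<in>I. \<forall>b\<in>I. a + b \<in> I) \<and> (\<forall>r. \<forall>a\<in>I. r * a \<in> I)) hull S"
  using module.span_def[OF module_times, of S]
  by (simp add: ideal_generated_def module.subspace_def[OF module_times, abs_def])

definition radical :: "'a::comm_ring_1 set \<Rightarrow> 'a set" where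
  "radical I = {f. \<exists>r>0. f ^ r \<in> I}"


section \<open>The ring of sequences\<close>

text \<open>The ring structure on \<^typ>\<open>'m \<Rightarrow> 'k\<close> is the componentwise one of
  \<^theory>\<open>HOL-Library.Function_Algebras\<close>.\<close>

definition seq_act :: "'m::monoid_mult \<Rightarrow> ('m \<Rightarrow> 'k) \<Rightarrow> ('m \<Rightarrow> 'k)" where
  "seq_act m x = (\<lambda>l. x (l * m))"

definition seq_const :: "'k \<Rightarrow> ('m \<Rightarrow> 'k)" where
  "seq_const c = (\<lambda>_. c)"


section \<open>Monoid polynomials\<close>

text \<open>The pair \<^term>\<open>(m, i)\<close> stands for the indeterminate
  \<open>\<sigma>\<^sup>m(X\<^sub>i)\<close>. A monomial is a finitely supported map from indeterminates to exponents,
  and a polynomial is a finitely supported map from monomials to coefficients; multiplication is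
  the convolution product of \<^theory>\<open>HOL-Library.Poly_Mapping\<close>. The finite type
  \<^typ>\<open>'n\<close> indexes the tuple of variables.\<close>

type_synonym ('m, 'n, 'k) M_poly = "(('m \<times> 'n) \<Rightarrow>\<^sub>0 nat) \<Rightarrow>\<^sub>0 'k"

definition M_const :: "'k::comm_ring_1 \<Rightarrow> ('m, 'n, 'k) M_poly" where
  "M_const c = Poly_Mapping.single 0 c"

definition M_var :: "'m \<Rightarrow> 'n \<Rightarrow> ('m, 'n, 'k::comm_ring_1) M_poly" where
  "M_var m i = Poly_Mapping.single (Poly_Mapping.single (m, i) 1) 1"

text \<open>Substitution of ring elements \<^term>\<open>g v\<close> for the indeterminates \<^term>\<open>v\<close>,
  with coefficients mapped by \<^term>\<open>c\<close>.\<close>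

definition monom_subst :: "('v \<Rightarrow> 'b::comm_ring_1) \<Rightarrow> ('v \<Rightarrow>\<^sub>0 nat) \<Rightarrow> 'b" where
  "monom_subst g t = (\<Prod>v\<in>Poly_Mapping.keys t. g v ^ Poly_Mapping.lookup t v)"

definition poly_subst ::
  "('k::comm_ring_1 \<Rightarrow> 'b::comm_ring_1) \<Rightarrow> ('v \<Rightarrow> 'b) \<Rightarrow> (('v \<Rightarrow>\<^sub>0 nat) \<Rightarrow>\<^sub>0 'k) \<Rightarrow> 'b" where
  "poly_subst c g p =
     (\<Sum>t\<in>Poly_Mapping.keys p. c (Poly_Mapping.lookup p t) * monom_subst g t)"

definition M_act ::
  "'m::monoid_mult \<Rightarrow> ('m, 'n, 'k::comm_ring_1) M_poly \<Rightarrow> ('m, 'n, 'k) M_poly" where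
  "M_act m = poly_subst M_const (\<lambda>(m', i). M_var (m * m') i)"

text \<open>The tuple \<open>(x\<^sub>1, \<dots>, x\<^sub>n)\<close> is a function \<^term>\<open>x :: 'n \<Rightarrow> ('m \<Rightarrow> 'k)\<close>.
  Existence and uniqueness of the morphism below is \<open>ex1_M_eval_hom\<close>.\<close>

definition is_M_eval_hom ::
  "('n \<Rightarrow> ('m::monoid_mult \<Rightarrow> 'k::comm_ring_1)) \<Rightarrow>
     (('m, 'n, 'k) M_poly \<Rightarrow> ('m \<Rightarrow> 'k)) \<Rightarrow> bool" where
  "is_M_eval_hom x h \<longleftrightarrow>
     is_M_ring_hom M_act seq_act h \<and>
     (\<forall>c. h (M_const c) = seq_const c) \<and> (\<forall>i. h (M_var 1 i) = x i)"

definition M_eval ::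
  "('m, 'n, 'k) M_poly \<Rightarrow> ('n \<Rightarrow> ('m::monoid_mult \<Rightarrow> 'k::comm_ring_1)) \<Rightarrow> ('m \<Rightarrow> 'k)" where
  "M_eval f x = (THE h. is_M_eval_hom x h) f"

definition zero_locus ::
  "('m::monoid_mult, 'n, 'k::comm_ring_1) M_poly set \<Rightarrow> ('n \<Rightarrow> ('m \<Rightarrow> 'k)) set" where
  "zero_locus F = {x. \<forall>f\<in>F. M_eval f x = 0}"

definition vanishing_ideal ::
  "('n \<Rightarrow> ('m::monoid_mult \<Rightarrow> 'k::comm_ring_1)) set \<Rightarrow> ('m, 'n, 'k) M_poly set" where
  "vanishing_ideal S = {f. \<forall>x\<in>S. M_eval f x = 0}"


section \<open>The definitions are adequate\<close>

lemma monom_subst_superset: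
  assumes "finite A" "Poly_Mapping.keys t \<subseteq> A"
  shows "monom_subst g t = (\<Prod>v\<in>A. g v ^ Poly_Mapping.lookup t v)"
  unfolding monom_subst_def
  using assms by (intro prod.mono_neutral_left) (auto simp: in_keys_iff)

lemma monom_subst_add: "monom_subst g (s + t) = monom_subst g s * monom_subst g t"
proof -
  let ?A = "Poly_Mapping.keys s \<union> Poly_Mapping.keys t"
  have "monom_subst g (s + t) = (\<Prod>v\<in>?A. g v ^ Poly_Mapping.lookup (s + t) v)"
    by (rule monom_subst_superset) (use keys_add[of s t] in auto)
  also have "\<dots> = (\<Prod>v\<in>?A. g v ^ Poly_Mapping.lookup s v) * (\<Prod>v\<in>?A. g v ^ Poly_Mapping.lookup t v)"
    by (simp add: lookup_add power_add prod.distrib)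
  also have "\<dots> = monom_subst g s * monom_subst g t"
    by (simp add: monom_subst_superset[of ?A])
  finally show ?thesis .
qed

lemma monom_subst_0 [simp]: "monom_subst g 0 = 1"
  by (simp add: monom_subst_def)

lemma monom_subst_single [simp]: "monom_subst g (Poly_Mapping.single v (Suc 0)) = g v"
  by (simp add: monom_subst_def)

lemma poly_subst_superset:
  assumes "c 0 = 0" "finite A" "Poly_Mapping.keys p \<subseteq> A"
  shows "poly_subst c g p = (\<Sum>t\<in>A. c (Poly_Mapping.lookup p t) * monom_subst g t)"
  unfolding poly_subst_def
  using assms by (intro sum.mono_neutral_left) (auto simp: in_keys_iff)

lemma is_ring_hom_0: "is_ring_hom h \<Longrightarrow> h 0 = 0"
  unfolding is_ring_hom_def by (metis add_cancel_right_right)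

lemma poly_subst_add:
  assumes "is_ring_hom c"
  shows "poly_subst c g (p + q) = poly_subst c g p + poly_subst c g q"
proof -
  let ?A = "Poly_Mapping.keys p \<union> Poly_Mapping.keys q"
  note c0 = is_ring_hom_0[OF assms]
  have "poly_subst c g (p + q) = (\<Sum>t\<in>?A. c (Poly_Mapping.lookup (p + q) t) * monom_subst g t)"
    by (rule poly_subst_superset) (use keys_add[of p q] c0 in auto)
  also have "\<dots> = (\<Sum>t\<in>?A. c (Poly_Mapping.lookup p t) * monom_subst g t)
                + (\<Sum>t\<in>?A. c (Poly_Mapping.lookup q t) * monom_subst g t)"
    using assms by (simp add: lookup_add is_ring_hom_def distrib_right sum.distrib)
  also have "\<dots> = poly_subst c g p + poly_subst c g q"
    by (simp add: poly_subst_superset[where c = c and A = ?A] c0)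
  finally show ?thesis .
qed

lemma poly_subst_0 [simp]: "poly_subst c g 0 = 0"
  by (simp add: poly_subst_def)

lemma poly_subst_single:
  assumes "is_ring_hom c"
  shows "poly_subst c g (Poly_Mapping.single t a) = c a * monom_subst g t"
  using is_ring_hom_0[OF assms] by (simp add: poly_subst_def)

lemma poly_mapping_single_induct:
  fixes p :: "'a \<Rightarrow>\<^sub>0 'b::comm_monoid_add"
  assumes "P 0" and "\<And>p t a. P p \<Longrightarrow> P (p + Poly_Mapping.single t a)"
  shows "P p"
proof (induction p rule: update_induct)
  case const
  show ?case by (rule assms(1))
next
  case (update p t a)
  have "Poly_Mapping.update t a p = p + Poly_Mapping.single t a"
    using update(1)
    by (intro poly_mapping_eqI)
      (auto simp: lookup_update lookup_add lookup_single when_def in_keys_iff)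
  then show ?case using assms(2) update by simp
qed

lemma poly_subst_mult:
  assumes "is_ring_hom c"
  shows "poly_subst c g (p * q) = poly_subst c g p * poly_subst c g q"
proof (induction p rule: poly_mapping_single_induct)
  case 1
  show ?case by simp
next
  case (2 p s a)
  have "poly_subst c g (Poly_Mapping.single s a * q)
      = poly_subst c g (Poly_Mapping.single s a) * poly_subst c g q"
  proof (induction q rule: poly_mapping_single_induct)
    case 1
    show ?case by simp
  next
    case (2 q t b)
    have "c (a * b) = c a * c b" using assms by (simp add: is_ring_hom_def)
    then show ?case
      by (simp only: 2 distrib_left poly_subst_add[OF assms] mult_single
          poly_subst_single[OF assms] monom_subst_add) (simp only: mult_ac)
  qed
  then show ?case
    by (simp add: 2 distrib_right poly_subst_add[OF assms])
qed

lemma is_ring_hom_poly_subst: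
  assumes "is_ring_hom c"
  shows "is_ring_hom (poly_subst c g)"
proof -
  have "poly_subst c g 1 = 1"
    using poly_subst_single[OF assms, of g 0 1] assms by (simp add: is_ring_hom_def)
  then show ?thesis
    unfolding is_ring_hom_def using poly_subst_add[OF assms] poly_subst_mult[OF assms] by blast
qed

lemma is_ring_hom_M_const: "is_ring_hom M_const"
  by (simp add: is_ring_hom_def M_const_def single_add mult_single)

lemma is_ring_hom_seq_const: "is_ring_hom seq_const"
  by (simp add: is_ring_hom_def seq_const_def fun_eq_iff)

lemma poly_subst_M_const:
  assumes "is_ring_hom c"
  shows "poly_subst c g (M_const a) = c a"
  by (simp add: M_const_def poly_subst_single[OF assms])

lemma poly_subst_M_var:
  assumes "is_ring_hom c"
  shows "poly_subst c g (M_var m i) = g (m, i)"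
  using assms by (simp add: M_var_def poly_subst_single[OF assms] is_ring_hom_def)

text \<open>Ring homomorphisms out of the polynomial ring are determined on constants and
  indeterminates.\<close>

lemma M_poly_hom_eqI:
  fixes h h' :: "('m, 'n, 'k::comm_ring_1) M_poly \<Rightarrow> 'b::comm_ring_1"
  assumes h: "is_ring_hom h" and h': "is_ring_hom h'"
    and const: "\<And>c. h (M_const c) = h' (M_const c)"
    and var: "\<And>m i. h (M_var m i) = h' (M_var m i)"
  shows "h = h'"
proof
  fix p
  have pow: "h (Poly_Mapping.single (Poly_Mapping.single v k) 1)
           = h' (Poly_Mapping.single (Poly_Mapping.single v k) 1)" for v k
  proof (induction k)
    case 0
    show ?case using h h' by (simp add: is_ring_hom_def)
  next
    case (Suc k)
    obtain m i where v: "v = (m, i)" by (cases v)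
    have "(Poly_Mapping.single (Poly_Mapping.single v (Suc k)) 1 :: ('m, 'n, 'k) M_poly)
        = M_var m i * Poly_Mapping.single (Poly_Mapping.single v k) 1"
      by (simp add: M_var_def mult_single v single_add[symmetric])
    then show ?case using h h' var Suc by (simp add: is_ring_hom_def)
  qed
  have mono: "h (Poly_Mapping.single t 1) = h' (Poly_Mapping.single t 1)" for t
  proof (induction t rule: poly_mapping_single_induct)
    case 1
    show ?case using h h' by (simp add: is_ring_hom_def)
  next
    case (2 t v k)
    have "(Poly_Mapping.single (t + Poly_Mapping.single v k) 1 :: ('m, 'n, 'k) M_poly)
        = Poly_Mapping.single t 1 * Poly_Mapping.single (Poly_Mapping.single v k) 1"
      by (simp add: mult_single)
    then show ?case using h h' 2 pow by (simp add: is_ring_hom_def)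
  qed
  show "h p = h' p"
  proof (induction p rule: poly_mapping_single_induct)
    case 1
    show ?case using is_ring_hom_0[OF h] is_ring_hom_0[OF h'] by simp
  next
    case (2 p t a)
    have "Poly_Mapping.single t a = M_const a * Poly_Mapping.single t 1"
      by (simp add: M_const_def mult_single)
    then show ?case using h h' 2 mono const by (simp add: is_ring_hom_def)
  qed
qed

lemma is_ring_hom_comp: "is_ring_hom f \<Longrightarrow> is_ring_hom g \<Longrightarrow> is_ring_hom (f \<circ> g)"
  by (simp add: is_ring_hom_def)

lemma is_ring_hom_M_act: "is_ring_hom (M_act m)"
  unfolding M_act_def by (rule is_ring_hom_poly_subst[OF is_ring_hom_M_const])

lemma M_act_const [simp]: "M_act m (M_const c) = M_const c"
  by (simp add: M_act_def poly_subst_M_const[OF is_ring_hom_M_const])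

lemma M_act_var [simp]: "M_act m (M_var m' i) = M_var (m * m') i"
  by (simp add: M_act_def poly_subst_M_var[OF is_ring_hom_M_const])

lemma is_M_ring_M_act:
  "is_M_ring (M_act :: 'm::monoid_mult \<Rightarrow> ('m, 'n, 'k::comm_ring_1) M_poly \<Rightarrow> _)"
proof -
  have "M_act 1 = (id :: ('m, 'n, 'k) M_poly \<Rightarrow> _)"
    by (rule M_poly_hom_eqI[OF is_ring_hom_M_act]) (simp_all add: is_ring_hom_def)
  moreover have "M_act (m1 * m2) = (M_act m1 \<circ> M_act m2 :: ('m, 'n, 'k) M_poly \<Rightarrow> _)" for m1 m2
    by (rule M_poly_hom_eqI[OF is_ring_hom_M_act is_ring_hom_comp])
      (simp_all add: is_ring_hom_M_act mult.assoc)
  ultimately show ?thesis by (simp add: is_M_ring_def is_ring_hom_M_act)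
qed

lemma is_ring_hom_seq_act: "is_ring_hom (seq_act m)"
  by (simp add: is_ring_hom_def seq_act_def fun_eq_iff)

lemma is_M_ring_seq_act:
  "is_M_ring (seq_act :: 'm::monoid_mult \<Rightarrow> ('m \<Rightarrow> 'k::comm_ring_1) \<Rightarrow> _)"
  by (simp add: is_M_ring_def is_ring_hom_seq_act) (simp add: seq_act_def fun_eq_iff mult.assoc)

lemma is_M_eval_hom_poly_subst:
  "is_M_eval_hom x (poly_subst seq_const (\<lambda>(m, i). seq_act m (x i)))" (is "is_M_eval_hom x ?h")
proof -
  note c = is_ring_hom_seq_const
  have h: "is_ring_hom ?h" by (rule is_ring_hom_poly_subst[OF c])
  have "?h \<circ> M_act m = seq_act m \<circ> ?h" for m
  proof (rule M_poly_hom_eqI)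
    show "is_ring_hom (?h \<circ> M_act m)" "is_ring_hom (seq_act m \<circ> ?h)"
      by (rule is_ring_hom_comp[OF h is_ring_hom_M_act] is_ring_hom_comp[OF is_ring_hom_seq_act h])+
  qed (simp_all add: poly_subst_M_const[OF c] poly_subst_M_var[OF c],
      simp_all add: seq_act_def seq_const_def mult.assoc)
  then have "?h (M_act m a) = seq_act m (?h a)" for m a
    by (metis comp_apply)
  then show ?thesis
    by (simp add: is_M_eval_hom_def is_M_ring_hom_def h poly_subst_M_const[OF c]
        poly_subst_M_var[OF c]) (simp add: seq_act_def)
qed

lemma is_M_eval_hom_unique:
  assumes "is_M_eval_hom x h" "is_M_eval_hom x h'"
  shows "h = h'"
proof (rule M_poly_hom_eqI)
  show "is_ring_hom h" "is_ring_hom h'" "\<And>c. h (M_const c) = h' (M_const c)"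
    using assms by (simp_all add: is_M_eval_hom_def is_M_ring_hom_def)
  show "h (M_var m i) = h' (M_var m i)" for m i
  proof -
    have "k (M_act m (M_var 1 i)) = seq_act m (x i)" if "is_M_eval_hom x k" for k
      using that unfolding is_M_eval_hom_def is_M_ring_hom_def by metis
    then show ?thesis using assms by (metis M_act_var mult.right_neutral)
  qed
qed

lemma ex1_M_eval_hom: "\<exists>!h. is_M_eval_hom x h"
  using is_M_eval_hom_poly_subst is_M_eval_hom_unique by blast

lemma M_eval_hom: "is_M_eval_hom x (\<lambda>f. M_eval f x)"
  unfolding M_eval_def by (rule theI'[OF ex1_M_eval_hom])

lemma M_eval_explicit:
  "M_eval f x = poly_subst seq_const (\<lambda>(m, i). seq_act m (x i)) f"
  using fun_cong[OF is_M_eval_hom_unique[OF M_eval_hom[of x] is_M_eval_hom_poly_subst]] .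

end

theory Submission
  imports "HOL-Algebra.Free_Abelian_Groups" Defs
begin

text \<open>A sequence tuple \<open>x\<close> is a point \<open>\<xi>\<close> with a coordinate for each indeterminate, and evaluating the
  orbit of \<open>f\<close> at \<open>\<xi>\<close> gives the entries of \<open>f(x)\<close>. So the theorem becomes the Nullstellensatz for a
  polynomial ring whose set of indeterminates is finite or smaller than \<open>k\<close>. Let \<open>P\<close> be maximal
  among the ideals that contain a given ideal and no power of \<open>f\<close>; it is prime, and every \<open>h \<notin> P\<close>
  divides a power of \<open>f\<close> modulo \<open>P\<close>. One needs a zero of \<open>P\<close> at which \<open>f\<close> does not vanish.

  For infinitely many indeterminates, the ring has dimension less than \<open>|k|\<close> over \<open>k\<close>, while the
  inverses of \<open>X\<^sub>v - a\<close> for \<open>a \<in> k\<close> would be linearly independent if \<open>X\<^sub>v\<close> were transcendental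
  modulo \<open>P\<close>; so each \<open>X\<^sub>v\<close> is congruent to a constant.

  For finitely many, homomorphisms to \<open>k\<close> are extended one indeterminate at a time: if \<open>A\<close> is a
  subring and \<open>f \<in> A[b] - P\<close>, then some \<open>u \<in> A - P\<close> has the property that every homomorphism
  \<open>A/(A \<inter> P) \<rightarrow> k\<close> not killing \<open>u\<close> extends to \<open>A[b]/(A[b] \<inter> P)\<close> without killing \<open>f\<close>.\<close>

section \<open>Ideals, subrings and pseudo-division\<close>

definition is_ideal :: "'a::comm_ring_1 set \<Rightarrow> bool" where
  "is_ideal I \<longleftrightarrow> 0 \<in> I \<and> (\<forall>a\<in>I. \<forall>b\<in>I. a + b \<in> I) \<and> (\<forall>r. \<forall>a\<in>I. r * a \<in> I)"

definition is_prime_ideal :: "'a::comm_ring_1 set \<Rightarrow> bool" where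
  "is_prime_ideal P \<longleftrightarrow> is_ideal P \<and> 1 \<notin> P \<and> (\<forall>a b. a * b \<in> P \<longrightarrow> a \<in> P \<or> b \<in> P)"

definition is_subring :: "'a::comm_ring_1 set \<Rightarrow> bool" where
  "is_subring A \<longleftrightarrow> 1 \<in> A \<and> (\<forall>a\<in>A. \<forall>b\<in>A. a + b \<in> A \<and> a * b \<in> A) \<and> (\<forall>a\<in>A. - a \<in> A)"

text \<open>For a subring \<open>A\<close> this is \<open>A[X]\<close>. For an ideal
  \<open>P\<close> it is the kernel of reducing coefficients modulo \<open>P\<close>, so
  non-membership means being nonzero modulo \<open>P\<close> without forming a quotient
  ring.\<close>

definition polys_over :: "'a::comm_ring_1 set \<Rightarrow> 'a poly set" where
  "polys_over A = {p. \<forall>i. coeff p i \<in> A}"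

lemma ideal_generated_eq_hull: "ideal_generated S = is_ideal hull S"
  by (simp add: ideal_generated_hull is_ideal_def[abs_def])

lemma is_ideal_Inter: "(\<And>I. I \<in> T \<Longrightarrow> is_ideal I) \<Longrightarrow> is_ideal (\<Inter>T)"
  by (simp add: is_ideal_def)

lemma is_ideal_ideal_generated: "is_ideal (ideal_generated S)"
  unfolding ideal_generated_eq_hull by (rule hull_in) (auto intro: is_ideal_Inter)

lemma subset_ideal_generated: "S \<subseteq> ideal_generated S"
  unfolding ideal_generated_eq_hull by (rule hull_subset)

lemma ideal_generated_minimal: "S \<subseteq> I \<Longrightarrow> is_ideal I \<Longrightarrow> ideal_generated S \<subseteq> I"
  unfolding ideal_generated_eq_hull by (rule hull_minimal)

lemma
  assumes "is_ideal I"
  shows ideal_zero: "0 \<in> I"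
    and ideal_add: "a \<in> I \<Longrightarrow> b \<in> I \<Longrightarrow> a + b \<in> I"
    and ideal_mult_left: "a \<in> I \<Longrightarrow> r * a \<in> I"
    and ideal_mult_right: "a \<in> I \<Longrightarrow> a * r \<in> I"
    and ideal_uminus: "a \<in> I \<Longrightarrow> - a \<in> I"
    and ideal_diff: "a \<in> I \<Longrightarrow> b \<in> I \<Longrightarrow> a - b \<in> I"
proof -
  show "0 \<in> I" and add: "a \<in> I \<Longrightarrow> b \<in> I \<Longrightarrow> a + b \<in> I" and mult: "a \<in> I \<Longrightarrow> r * a \<in> I" for a b r
    using assms by (auto simp: is_ideal_def)
  then show "a \<in> I \<Longrightarrow> a * r \<in> I" by (simp add: mult.commute)
  show um: "a \<in> I \<Longrightarrow> - a \<in> I" for a using mult[of a "-1"] by simp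
  show "a \<in> I \<Longrightarrow> b \<in> I \<Longrightarrow> a - b \<in> I" using add[of a "-b"] um[of b] by simp
qed

lemma ideal_sum:
  assumes "is_ideal I" "\<And>x. x \<in> S \<Longrightarrow> g x \<in> I"
  shows "sum g S \<in> I"
  using assms(2) by (induction S rule: infinite_finite_induct)
    (auto intro: ideal_zero[OF assms(1)] ideal_add[OF assms(1)])

lemma
  assumes "is_subring A"
  shows subring_one: "1 \<in> A"
    and subring_zero: "0 \<in> A"
    and subring_add: "a \<in> A \<Longrightarrow> b \<in> A \<Longrightarrow> a + b \<in> A"
    and subring_mult: "a \<in> A \<Longrightarrow> b \<in> A \<Longrightarrow> a * b \<in> A"
    and subring_uminus: "a \<in> A \<Longrightarrow> - a \<in> A"
    and subring_diff: "a \<in> A \<Longrightarrow> b \<in> A \<Longrightarrow> a - b \<in> A"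
proof -
  show "1 \<in> A" and add: "a \<in> A \<Longrightarrow> b \<in> A \<Longrightarrow> a + b \<in> A" 
    and "a \<in> A \<Longrightarrow> b \<in> A \<Longrightarrow> a * b \<in> A" and um: "a \<in> A \<Longrightarrow> - a \<in> A" for a b
    using assms by (auto simp: is_subring_def)
  then show "0 \<in> A" using add[of 1 "-1"] by simp
  show "a \<in> A \<Longrightarrow> b \<in> A \<Longrightarrow> a - b \<in> A" using add[of a "-b"] um[of b] by simp
qed

lemma subring_sum:
  assumes "is_subring A" "\<And>x. x \<in> S \<Longrightarrow> g x \<in> A"
  shows "sum g S \<in> A"
  using assms(2) by (induction S rule: infinite_finite_induct)
    (auto intro: subring_zero[OF assms(1)] subring_add[OF assms(1)])

lemma subring_power: "is_subring A \<Longrightarrow> a \<in> A \<Longrightarrow> a ^ n \<in> A"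
  by (induction n) (auto intro: subring_one subring_mult)

section \<open>Polynomials with coefficients in a subring or an ideal\<close>

lemma coeff_polys_over: "p \<in> polys_over A \<Longrightarrow> coeff p i \<in> A"
  by (simp add: polys_over_def)

lemma is_subring_polys_over:
  assumes "is_subring A"
  shows "is_subring (polys_over A)"
  using assms unfolding is_subring_def[of "polys_over A"]
  by (auto simp: polys_over_def coeff_mult
      intro!: subring_one subring_zero subring_sum subring_add subring_mult subring_uminus)

lemma is_ideal_polys_over:
  assumes "is_ideal P"
  shows "is_ideal (polys_over P)"
  using assms unfolding is_ideal_def[of "polys_over P"]
  by (auto simp: polys_over_def coeff_mult
      intro!: ideal_zero ideal_add ideal_sum ideal_mult_left)

lemma monom_in_polys_over: "0 \<in> A \<Longrightarrow> a \<in> A \<Longrightarrow> monom a n \<in> polys_over A"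
  by (simp add: polys_over_def)

lemma const_in_polys_over: "0 \<in> A \<Longrightarrow> a \<in> A \<Longrightarrow> [:a:] \<in> polys_over A"
  by (simp add: polys_over_def coeff_pCons split: nat.split)

lemma poly_polys_over_ideal: "is_ideal P \<Longrightarrow> p \<in> polys_over P \<Longrightarrow> poly p b \<in> P"
  by (auto simp: poly_altdef polys_over_def intro!: ideal_sum ideal_mult_right)

lemma prime_ideal_power: "is_prime_ideal P \<Longrightarrow> a ^ n \<in> P \<Longrightarrow> a \<in> P"
  by (induction n) (auto simp: is_prime_ideal_def)

text \<open>Each step multiplies \<open>p\<close> by the leading coefficient of \<open>g\<close>,
  which need not be invertible, and cancels the top term. The bound on \<open>degree s\<close> later
  shows that a quotient by a nonconstant \<open>g\<close> has smaller degree.\<close>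

lemma pseudo_division_over:
  assumes A: "is_subring A" and g: "g \<in> polys_over A" and p: "p \<in> polys_over A"
  shows "\<exists>e s r. s \<in> polys_over A \<and> r \<in> polys_over A \<and>
           smult (lead_coeff g ^ e) p = s * g + r \<and>
           (r = 0 \<or> degree r < degree g) \<and> (s = 0 \<or> degree s + degree g \<le> degree p)"
  using p
proof (induction "degree p" arbitrary: p rule: less_induct)
  case less
  note AX = is_subring_polys_over[OF A]
  show ?case
  proof (cases "p = 0 \<or> degree p < degree g")
    case True
    then show ?thesis using less.prems subring_zero[OF AX]
      by (intro exI[of _ 0] exI[of _ p]) (auto intro: exI[of _ "0::nat"])
  next
    case False
    let ?a = "lead_coeff g" let ?n = "degree p - degree g"
    let ?m = "monom (lead_coeff p) ?n"
    define p' where "p' = smult ?a p - ?m * g"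
    have a: "?a \<in> A" using g coeff_polys_over by blast
    have m: "?m \<in> polys_over A"
      using less.prems coeff_polys_over subring_zero[OF A] by (intro monom_in_polys_over) auto
    have sm: "smult c q \<in> polys_over A" if "c \<in> A" "q \<in> polys_over A" for c q
      using that subring_mult[OF A] by (auto simp: polys_over_def)
    have p'A: "p' \<in> polys_over A"
      unfolding p'_def by (intro subring_diff[OF AX] subring_mult[OF AX] sm a m g less.prems)
    have dm: "degree (?m * g) \<le> degree p"
      using degree_mult_le[of ?m g] degree_monom_le[of "lead_coeff p" ?n] False by linarith
    have dp': "degree p' \<le> degree p"
      unfolding p'_def using dm degree_smult_le[of ?a p] by (intro degree_diff_le) auto
    have "coeff p' (degree p) = 0"
      using False by (simp add: p'_def coeff_monom_mult)
    show ?thesis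
    proof (cases "degree p' < degree p")
      case True
      from less.hyps[OF this p'A] obtain e s r where
        IH: "s \<in> polys_over A" "r \<in> polys_over A" "smult (?a ^ e) p' = s * g + r"
          "r = 0 \<or> degree r < degree g" "s = 0 \<or> degree s + degree g \<le> degree p'" by blast
      let ?s = "s + smult (?a ^ e) ?m"
      have "degree ?s \<le> ?n"
        using IH(5) True False degree_smult_le[of "?a ^ e" ?m] degree_monom_le[of "lead_coeff p" ?n]
        by (intro degree_add_le) auto
      then have "degree ?s + degree g \<le> degree p" using False by linarith
      moreover have "smult (?a ^ Suc e) p = ?s * g + r"
        using IH(3) by (simp add: p'_def algebra_simps smult_diff_right)
      moreover have "?s \<in> polys_over A"
        by (intro subring_add[OF AX] IH sm subring_power[OF A] a m)
      ultimately show ?thesis using IH by blast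
    next
      case F: False
      \<comment> \<open>Here \<open>p'\<close> has the degree of \<open>p\<close> but coefficient 0
        there, so it is 0; this happens only for constant \<open>p\<close>.\<close>
      with dp' \<open>coeff p' (degree p) = 0\<close> have "p' = 0"
        by (metis leading_coeff_0_iff le_neq_implies_less)
      moreover have "degree ?m + degree g \<le> degree p"
        using degree_monom_le[of "lead_coeff p" ?n] False by linarith
      ultimately show ?thesis using m subring_zero[OF AX]
        by (intro exI[of _ 1] exI[of _ ?m] exI[of _ 0]) (simp add: p'_def)
    qed
  qed
qed

text \<open>Pseudo-division by an element of least degree, where polynomials are counted as zero when
  all their coefficients lie in \<open>P\<close>.\<close>

lemma least_degree_divisor:
  assumes A: "is_subring A" and P: "is_prime_ideal P"
    and PJ: "P \<subseteq> J" and J_add: "\<And>x y. x \<in> J \<Longrightarrow> y \<in> J \<Longrightarrow> x + y \<in> J"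
    and J_mult: "\<And>p x. p \<in> polys_over A \<Longrightarrow> x \<in> J \<Longrightarrow> poly p b * x \<in> J"
    and ex: "\<exists>p\<in>polys_over A. poly p b \<in> J \<and> p \<notin> polys_over P"
  shows "\<exists>g\<in>polys_over A. poly g b \<in> J \<and> lead_coeff g \<notin> P \<and>
    (\<forall>r\<in>polys_over A. poly r b \<in> J \<and> degree r < degree g \<longrightarrow> r \<in> polys_over P) \<and>
    (\<forall>p\<in>polys_over A. poly p b \<in> J \<longrightarrow>
      (\<exists>e. \<exists>s\<in>polys_over A. smult (lead_coeff g ^ e) p - s * g \<in> polys_over P \<and>
         (s = 0 \<or> degree s + degree g \<le> degree p)))"
proof -
  note AX = is_subring_polys_over[OF A]
  have Pi: "is_ideal P" using P by (simp add: is_prime_ideal_def)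
  define T where "T = {p \<in> polys_over A. poly p b \<in> J}"
  \<comment> \<open>The coefficients above the last one outside \<open>P\<close> are discarded. This
    changes the value at \<open>b\<close> by an element of \<open>P \<subseteq> J\<close>, so
    membership in \<open>T\<close> survives.\<close>
  have T_cut: "\<exists>p'\<in>T. lead_coeff p' \<notin> P \<and> degree p' \<le> degree p" if "p \<in> T" "p \<notin> polys_over P" for p
  proof -
    define N where "N = {i. coeff p i \<notin> P}"
    have sub: "N \<subseteq> {..degree p}"
      using ideal_zero[OF Pi] by (auto simp: N_def intro: le_degree)
    then have fin: "finite N" by (rule finite_subset) simp
    have ne: "N \<noteq> {}" using that by (auto simp: N_def polys_over_def)
    define n where "n = Max N"
    have n: "coeff p n \<notin> P" using Max_in[OF fin ne] by (simp add: n_def N_def)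
    have big: "coeff p i \<in> P" if "i > n" for i
      using Max_ge[OF fin, of i] that by (auto simp: n_def N_def)
    let ?q = "poly_cutoff (Suc n) p"
    have cq: "coeff ?q n \<notin> P" using n by (simp add: coeff_poly_cutoff)
    have "degree ?q \<le> n" by (rule degree_le) (simp add: coeff_poly_cutoff)
    moreover have "coeff ?q n \<noteq> 0" using cq ideal_zero[OF Pi] by metis
    ultimately have deg: "degree ?q = n" by (meson le_antisym le_degree)
    have qA: "?q \<in> polys_over A"
      using that subring_zero[OF A] by (auto simp: T_def polys_over_def coeff_poly_cutoff)
    have "?q - p \<in> polys_over P"
      using big ideal_zero[OF Pi] ideal_uminus[OF Pi]
      by (auto simp: polys_over_def coeff_poly_cutoff)
    then have "poly (?q - p) b \<in> P" by (rule poly_polys_over_ideal[OF Pi])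
    then have "poly (?q - p) b + poly p b \<in> J"
      using that PJ by (intro J_add) (auto simp: T_def)
    then have "?q \<in> T" using qA by (simp add: T_def)
    moreover have "n \<le> degree p" using sub n by (auto simp: N_def)
    ultimately show ?thesis using deg cq by (intro bexI[of _ ?q]) simp_all
  qed
  then obtain p0 where "p0 \<in> T \<and> lead_coeff p0 \<notin> P" using ex by (auto simp: T_def)
  then obtain g where g: "g \<in> T" "lead_coeff g \<notin> P"
    and least: "\<And>p. p \<in> T \<and> lead_coeff p \<notin> P \<Longrightarrow> degree g \<le> degree p"
    using ex_has_least_nat[of "\<lambda>p. p \<in> T \<and> lead_coeff p \<notin> P" p0 degree] by blast
  have small: "r \<in> polys_over P" if "r \<in> T" "degree r < degree g" for r
    using T_cut[OF that(1)] least that(2) by (meson leD le_trans)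
  show ?thesis
  proof (intro bexI[of _ g] conjI ballI impI)
    show "g \<in> polys_over A" "poly g b \<in> J" "lead_coeff g \<notin> P" using g by (auto simp: T_def)
    show "r \<in> polys_over P" if "r \<in> polys_over A" "poly r b \<in> J \<and> degree r < degree g" for r
      using small that by (simp add: T_def)
    fix p assume p: "p \<in> polys_over A" "poly p b \<in> J"
    obtain e s r where d: "s \<in> polys_over A" "r \<in> polys_over A"
      "smult (lead_coeff g ^ e) p = s * g + r" "r = 0 \<or> degree r < degree g"
      "s = 0 \<or> degree s + degree g \<le> degree p"
      using pseudo_division_over[OF A _ p(1), of g] g by (auto simp: T_def)
    \<comment> \<open>As a combination of \<open>p\<close> and \<open>g\<close> over
      \<open>A[X]\<close>, the remainder has its value in \<open>J\<close>, so the minimality of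
      \<open>g\<close> makes it vanish modulo \<open>P\<close>.\<close>
    have r: "r = [:lead_coeff g ^ e:] * p + (- s) * g" using d(3) by (simp add: algebra_simps)
    have "poly r b = poly [:lead_coeff g ^ e:] b * poly p b + poly (- s) b * poly g b"
      unfolding r by simp
    also have "\<dots> \<in> J"
      using g p d coeff_polys_over[of g A]
      by (intro J_add J_mult const_in_polys_over subring_power[OF A] subring_zero[OF A]
          subring_uminus[OF AX]) (auto simp: T_def)
    finally have "r \<in> T" using d by (simp add: T_def)
    then have "r \<in> polys_over P"
      using d(4) small ideal_zero[OF is_ideal_polys_over[OF Pi]] by blast
    then show "\<exists>e. \<exists>s\<in>polys_over A. smult (lead_coeff g ^ e) p - s * g \<in> polys_over P \<and>
         (s = 0 \<or> degree s + degree g \<le> degree p)"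
      using d by (intro exI[of _ e] bexI[of _ s]) auto
  qed
qed

section \<open>Extension of homomorphisms to an algebraically closed field\<close>

lemma ring_hom_simps:
  assumes "is_ring_hom h"
  shows "h 0 = 0" "h 1 = 1" "h (a + b) = h a + h b" "h (a * b) = h a * h b"
    "h (- a) = - h a" "h (a - b) = h a - h b" "h (a ^ n) = h a ^ n"
proof -
  show z: "h 0 = 0" by (rule is_ring_hom_0[OF assms])
  show o: "h 1 = 1" and add: "\<And>a b. h (a + b) = h a + h b" and mult: "\<And>a b. h (a * b) = h a * h b"
    using assms by (auto simp: is_ring_hom_def)
  have um: "h (- a) = - h a" for a
    using add[of a "-a"] z by (simp add: eq_neg_iff_add_eq_0 add.commute)
  then show "h (- a) = - h a" .
  show "h (a - b) = h a - h b" using add[of a "-b"] um by simp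
  show "h (a ^ n) = h a ^ n" by (induction n) (simp_all add: o mult)
qed

lemma ring_hom_sum: "is_ring_hom h \<Longrightarrow> h (sum g S) = (\<Sum>x\<in>S. h (g x))"
  by (induction S rule: infinite_finite_induct) (simp_all add: ring_hom_simps)

text \<open>Over a finite field, the product of all \<open>X - a\<close> plus 1 would be nonconstant
  and have no root.\<close>

lemma infinite_alg_closed_field: "infinite (UNIV :: 'k::alg_closed_field set)"
proof
  assume fin: "finite (UNIV :: 'k set)"
  let ?p = "(\<Prod>a\<in>(UNIV :: 'k set). [:-a, 1:]) + 1"
  have "degree (\<Prod>a\<in>(UNIV :: 'k set). [:-a, 1:]) = card (UNIV :: 'k set)"
    by (subst degree_prod_eq_sum_degree) auto
  moreover have "card (UNIV :: 'k set) > 0" using fin by (simp add: card_gt_0_iff)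
  ultimately have "degree ?p > 0" by (subst degree_add_eq_left) auto
  then obtain x where "poly ?p x = 0" using alg_closed_imp_poly_has_root by blast
  moreover have "poly ?p x = 1" using fin by (simp add: poly_prod prod_zero_iff)
  ultimately show False by simp
qed

lemma ex_non_root:
  fixes p :: "'k::alg_closed_field poly"
  assumes "p \<noteq> 0"
  shows "\<exists>c. poly p c \<noteq> 0"
proof (rule ccontr)
  assume "\<nexists>c. poly p c \<noteq> 0"
  then have "{c. poly p c = 0} = UNIV" by auto
  then show False using poly_roots_finite[OF assms] infinite_alg_closed_field by metis
qed

text \<open>In the extension argument \<open>h'\<close> is \<open>\<phi>0\<close>, a function tied
  to the homomorphism \<open>h\<close> only through its values on the coefficients.\<close>

lemma ring_hom_poly:
  assumes "is_ring_hom h" and "\<And>i. h (coeff p i) = h' (coeff p i)" and "h' 0 = 0"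
  shows "h (poly p b) = poly (map_poly h' p) (h b)"
proof -
  have "h (poly p b) = (\<Sum>i\<le>degree p. h' (coeff p i) * h b ^ i)"
    by (simp add: poly_altdef ring_hom_sum[OF assms(1)] ring_hom_simps[OF assms(1)] assms(2))
  also have "\<dots> = (\<Sum>i\<le>degree (map_poly h' p). h' (coeff p i) * h b ^ i)"
  proof (rule sum.mono_neutral_right)
    show "{..degree (map_poly h' p)} \<subseteq> {..degree p}" 
      using degree_le[of "degree p" "map_poly h' p"] by (simp add: coeff_map_poly assms(3) coeff_eq_0)
    show "\<forall>i\<in>{..degree p} - {..degree (map_poly h' p)}. h' (coeff p i) * h b ^ i = 0"
      using coeff_eq_0[of "map_poly h' p"] by (auto simp: coeff_map_poly assms(3) not_le)
  qed simp
  also have "\<dots> = poly (map_poly h' p) (h b)"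
    by (simp add: poly_altdef coeff_map_poly assms(3))
  finally show ?thesis .
qed

text \<open>The family \<open>\<phi>\<close> consists of the extensions of one homomorphism on \<open>A\<close> to \<open>A[b]\<close>,
  indexed by the image of \<open>b\<close>.\<close>

lemma ring_hom_extension:
  fixes P :: "'r::comm_ring_1 set"
  assumes A: "is_subring A" and P: "is_prime_ideal P"
    and p: "p \<in> polys_over A" and f: "poly p b \<notin> P"
  shows "\<exists>u\<in>A - P. \<forall>(\<phi> :: 'k::alg_closed_field \<Rightarrow> 'r \<Rightarrow> 'k) \<phi>0.
    (\<forall>c. is_ring_hom (\<phi> c)) \<and> (\<forall>c. \<phi> c b = c) \<and> (\<forall>c. \<forall>a\<in>A. \<phi> c a = \<phi>0 a) \<and>
    (\<forall>a\<in>A \<inter> P. \<phi>0 a = 0) \<and> \<phi>0 u \<noteq> 0 \<longrightarrow>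
    (\<exists>c. \<phi> c (poly p b) \<noteq> 0 \<and> (\<forall>g\<in>polys_over A. poly g b \<in> P \<longrightarrow> \<phi> c (poly g b) = 0))"
proof -
  note AX = is_subring_polys_over[OF A]
  have Pi: "is_ideal P" and prime: "\<And>a b. a * b \<in> P \<Longrightarrow> a \<in> P \<or> b \<in> P"
    using P by (auto simp: is_prime_ideal_def)
  note PX = is_ideal_polys_over[OF Pi]
  have kill: "h (poly g b) = 0"
    if "is_ring_hom h" "\<forall>a\<in>A \<inter> P. h a = 0" "g \<in> polys_over A" "g \<in> polys_over P"
    for h :: "'r \<Rightarrow> 'k" and g
  proof -
    have "h (coeff g i) = 0" for i
      using that(2) coeff_polys_over[OF that(3)] coeff_polys_over[OF that(4)] by blast
    then show ?thesis
      unfolding poly_altdef by (simp only: ring_hom_sum[OF that(1)] ring_hom_simps[OF that(1)]) simp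
  qed
  show ?thesis
  proof (cases "\<exists>q\<in>polys_over A. poly q b \<in> P \<and> q \<notin> polys_over P")
    case False
    \<comment> \<open>Here \<open>b\<close> is transcendental over \<open>A\<close> modulo
      \<open>P\<close>, so its image is free. If a coefficient of \<open>p\<close> outside
      \<open>P\<close> is not killed, the image of \<open>p\<close> is a nonzero polynomial, and any
      non-root serves.\<close>
    have "p \<notin> polys_over P" using f poly_polys_over_ideal[OF Pi] by blast
    then obtain j where j: "coeff p j \<notin> P" by (auto simp: polys_over_def)
    show ?thesis
    proof (intro bexI[of _ "coeff p j"] allI impI)
      show "coeff p j \<in> A - P" using j coeff_polys_over[OF p] by blast
      fix \<phi> :: "'k \<Rightarrow> 'r \<Rightarrow> 'k" and \<phi>0
      assume "(\<forall>c. is_ring_hom (\<phi> c)) \<and> (\<forall>c. \<phi> c b = c) \<and> (\<forall>c. \<forall>a\<in>A. \<phi> c a = \<phi>0 a) \<and>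
        (\<forall>a\<in>A \<inter> P. \<phi>0 a = 0) \<and> \<phi>0 (coeff p j) \<noteq> 0"
      then have hom: "\<And>c. is_ring_hom (\<phi> c)" and b: "\<And>c. \<phi> c b = c"
        and same: "\<And>c a. a \<in> A \<Longrightarrow> \<phi> c a = \<phi>0 a" and zero: "\<forall>a\<in>A \<inter> P. \<phi>0 a = 0"
        and u: "\<phi>0 (coeff p j) \<noteq> 0" by auto
      have zero0: "\<phi>0 0 = 0" using same[OF subring_zero[OF A], of 0] ring_hom_simps(1)[OF hom] by simp
      have "coeff (map_poly (\<phi>0) p) j \<noteq> 0"
        using u by (simp add: coeff_map_poly zero0)
      then have "map_poly (\<phi>0) p \<noteq> 0" by auto
      then obtain c where "poly (map_poly (\<phi>0) p) c \<noteq> 0" using ex_non_root by blast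
      then have "\<phi> c (poly p b) \<noteq> 0"
        using ring_hom_poly[OF hom, of c p "\<phi>0" b] same coeff_polys_over[OF p]
          zero0 b by simp
      moreover have "\<phi> c (poly g b) = 0" if "g \<in> polys_over A" "poly g b \<in> P" for g
        using that False same zero by (intro kill[OF hom]) auto
      ultimately show "\<exists>c. \<phi> c (poly p b) \<noteq> 0 \<and>
          (\<forall>g\<in>polys_over A. poly g b \<in> P \<longrightarrow> \<phi> c (poly g b) = 0)" by blast
    qed
  next
    case True
    have "\<And>x y. x \<in> P \<Longrightarrow> y \<in> P \<Longrightarrow> x + y \<in> P" "\<And>p x. p \<in> polys_over A \<Longrightarrow> x \<in> P \<Longrightarrow> poly p b * x \<in> P"
      using Pi by (auto simp: is_ideal_def)
    \<comment> \<open>Here \<open>b\<close> is algebraic modulo \<open>P\<close>, and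
      \<open>q\<close> plays the role of its minimal polynomial.\<close>
    from least_degree_divisor[OF A P subset_refl this True] obtain q where
      q: "q \<in> polys_over A" "poly q b \<in> P" "lead_coeff q \<notin> P"
      and q_least: "\<forall>r\<in>polys_over A. poly r b \<in> P \<and> degree r < degree q \<longrightarrow> r \<in> polys_over P"
      and q_div: "\<forall>p\<in>polys_over A. poly p b \<in> P \<longrightarrow>
        (\<exists>e. \<exists>s\<in>polys_over A. smult (lead_coeff q ^ e) p - s * q \<in> polys_over P \<and>
         (s = 0 \<or> degree s + degree q \<le> degree p))" by blast
    \<comment> \<open>The sum of \<open>P\<close> and the multiples of \<open>poly p b\<close> in
      \<open>A[b]\<close>. An element of \<open>A - P\<close> in \<open>J\<close> is sought: where
      it does not vanish, \<open>poly p b\<close> cannot vanish either.\<close>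
    define J where "J = {poly p b * poly s b + t | s t. s \<in> polys_over A \<and> t \<in> P}"
    have JI: "poly p b * poly s b + t \<in> J" if "s \<in> polys_over A" "t \<in> P" for s t
      using that by (auto simp: J_def)
    have PJ: "P \<subseteq> J" using JI[of 0] subring_zero[OF AX] by auto
    have pJ: "poly p b \<in> J" using JI[of 1 0] subring_one[OF AX] ideal_zero[OF Pi] by simp
    have J_add: "x + y \<in> J" if "x \<in> J" "y \<in> J" for x y
    proof -
      from that obtain s t s' t' where "s \<in> polys_over A" "t \<in> P" "s' \<in> polys_over A" "t' \<in> P"
        "x = poly p b * poly s b + t" "y = poly p b * poly s' b + t'" by (auto simp: J_def)
      then show ?thesis using JI[of "s + s'" "t + t'"] subring_add[OF AX] ideal_add[OF Pi]
        by (simp add: algebra_simps)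
    qed
    have J_mult: "poly r b * x \<in> J" if "r \<in> polys_over A" "x \<in> J" for r x
    proof -
      from that obtain s t where "s \<in> polys_over A" "t \<in> P" "x = poly p b * poly s b + t"
        by (auto simp: J_def)
      then show ?thesis using that JI[of "r * s" "poly r b * t"] subring_mult[OF AX] ideal_mult_left[OF Pi]
        by (simp add: algebra_simps)
    qed
    have "\<exists>p\<in>polys_over A. poly p b \<in> J \<and> p \<notin> polys_over P" using True PJ by blast
    \<comment> \<open>Up to powers of its leading coefficient, \<open>g\<close> is a greatest common
      divisor of \<open>p\<close> and \<open>q\<close> modulo \<open>P\<close>.\<close>
    from least_degree_divisor[OF A P PJ J_add J_mult this] obtain g where
      g: "g \<in> polys_over A" "poly g b \<in> J" "lead_coeff g \<notin> P"
      and g_div: "\<forall>p\<in>polys_over A. poly p b \<in> J \<longrightarrow>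
        (\<exists>e. \<exists>s\<in>polys_over A. smult (lead_coeff g ^ e) p - s * g \<in> polys_over P \<and>
         (s = 0 \<or> degree s + degree g \<le> degree p))" by blast
    have ndvd: "poly g b \<notin> P"
    proof
      assume "poly g b \<in> P"
      obtain e s where "smult (lead_coeff g ^ e) p - s * g \<in> polys_over P"
        using g_div p pJ by blast
      from poly_polys_over_ideal[OF Pi this, of b]
      have "lead_coeff g ^ e * poly p b - poly s b * poly g b \<in> P" by simp
      from ideal_add[OF Pi this ideal_mult_left[OF Pi \<open>poly g b \<in> P\<close>, of "poly s b"]]
      have "lead_coeff g ^ e * poly p b \<in> P" by simp
      then show False using prime f g prime_ideal_power[OF P] by blast
    qed
    \<comment> \<open>For nonconstant \<open>g\<close>, the quotient \<open>s\<close> of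
      \<open>q\<close> by \<open>g\<close> has smaller degree than \<open>q\<close> and
      \<open>poly s b \<in> P\<close>. Minimality of \<open>q\<close> makes \<open>s\<close> vanish
      modulo \<open>P\<close>, and then \<open>q\<close> would vanish as well.\<close>
    have deg_g: "degree g = 0"
    proof (rule ccontr)
      assume pos: "degree g \<noteq> 0"
      obtain e s where s: "s \<in> polys_over A" "smult (lead_coeff g ^ e) q - s * g \<in> polys_over P"
        "s = 0 \<or> degree s + degree g \<le> degree q" using g_div q PJ by blast
      from poly_polys_over_ideal[OF Pi s(2), of b]
      have "lead_coeff g ^ e * poly q b - poly s b * poly g b \<in> P" by simp
      from ideal_diff[OF Pi ideal_mult_left[OF Pi q(2), of "lead_coeff g ^ e"] this]
      have "poly s b \<in> P" using prime ndvd by auto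
      then have "s \<in> polys_over P"
        using s pos q_least ideal_zero[OF PX] by (cases "s = 0") auto
      from ideal_add[OF PX s(2) ideal_mult_right[OF PX this, of g]]
      have "coeff (smult (lead_coeff g ^ e) q) (degree q) \<in> P" using coeff_polys_over by fastforce
      then have "lead_coeff g ^ e * lead_coeff q \<in> P" by simp
      then show False using prime g q prime_ideal_power[OF P] by blast
    qed
    define w where "w = coeff g 0"
    have w: "w \<in> A - P" using g deg_g coeff_polys_over[OF g(1)] by (simp add: w_def)
    have "poly g b = w" using deg_g by (simp add: w_def poly_altdef)
    then obtain s t where st: "s \<in> polys_over A" "t \<in> P" "w = poly p b * poly s b + t"
      using g(2) by (auto simp: J_def)
    have deg_q: "degree q > 0"
    proof (rule ccontr)
      assume "\<not> degree q > 0"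
      then have "poly q b = lead_coeff q" by (simp add: poly_altdef)
      then show False using q by simp
    qed
    show ?thesis
    \<comment> \<open>If \<open>lead_coeff q\<close> is not killed, the image of \<open>q\<close>
      stays nonconstant and has a root, to which \<open>b\<close> is sent; if \<open>w\<close> is
      not killed, neither is \<open>poly p b\<close>.\<close>
    proof (intro bexI[of _ "lead_coeff q * w"] allI impI)
      show "lead_coeff q * w \<in> A - P"
        using q w prime subring_mult[OF A] coeff_polys_over[OF q(1)] by blast
      fix \<phi> :: "'k \<Rightarrow> 'r \<Rightarrow> 'k" and \<phi>0
      assume "(\<forall>c. is_ring_hom (\<phi> c)) \<and> (\<forall>c. \<phi> c b = c) \<and> (\<forall>c. \<forall>a\<in>A. \<phi> c a = \<phi>0 a) \<and>
        (\<forall>a\<in>A \<inter> P. \<phi>0 a = 0) \<and> \<phi>0 (lead_coeff q * w) \<noteq> 0"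
      then have hom: "\<And>c. is_ring_hom (\<phi> c)" and b: "\<And>c. \<phi> c b = c"
        and same: "\<And>c a. a \<in> A \<Longrightarrow> \<phi> c a = \<phi>0 a" and zero: "\<forall>a\<in>A \<inter> P. \<phi>0 a = 0"
        and "\<phi>0 (lead_coeff q * w) \<noteq> 0" by auto
      have "\<phi>0 (lead_coeff q * w) = \<phi>0 (lead_coeff q) * \<phi>0 w"
        using same[of _ 0] w coeff_polys_over[OF q(1)] subring_mult[OF A] ring_hom_simps(4)[OF hom]
        by (metis Diff_iff)
      with \<open>\<phi>0 (lead_coeff q * w) \<noteq> 0\<close> have u: "\<phi>0 (lead_coeff q) \<noteq> 0" "\<phi>0 w \<noteq> 0" by auto
      have zero0: "\<phi>0 0 = 0" using same[OF subring_zero[OF A], of 0] ring_hom_simps(1)[OF hom] by simp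
      have "coeff (map_poly (\<phi>0) q) (degree q) \<noteq> 0"
        using u by (simp add: coeff_map_poly zero0)
      then have "degree (map_poly (\<phi>0) q) > 0" using deg_q le_degree by fastforce
      then obtain c where "poly (map_poly (\<phi>0) q) c = 0" using alg_closed_imp_poly_has_root by blast
      then have q0: "\<phi> c (poly q b) = 0"
        using ring_hom_poly[OF hom, of c q "\<phi>0" b] same coeff_polys_over[OF q(1)]
          zero0 b by simp
      \<comment> \<open>Modulo \<open>P\<close>, a power of \<open>lead_coeff q\<close> times
        \<open>r\<close> is a multiple of \<open>q\<close>, and the image of that power can be
        cancelled.\<close>
      have van: "\<phi> c (poly r b) = 0" if r: "r \<in> polys_over A" "poly r b \<in> P" for r
      proof -
        obtain e s where s: "s \<in> polys_over A" "smult (lead_coeff q ^ e) r - s * q \<in> polys_over P"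
          using q_div r by blast
        have "smult (lead_coeff q ^ e) r - s * q = [:lead_coeff q ^ e:] * r - s * q" by simp
        also have "\<dots> \<in> polys_over A"
          by (intro subring_diff[OF AX] subring_mult[OF AX] s r q const_in_polys_over subring_zero[OF A]
              subring_power[OF A] coeff_polys_over)
        finally have "\<phi> c (poly (smult (lead_coeff q ^ e) r - s * q) b) = 0"
          using s same zero by (intro kill[OF hom]) auto
        then have "\<phi> c (lead_coeff q) ^ e * \<phi> c (poly r b) = 0"
          by (simp add: ring_hom_simps[OF hom] q0)
        then show ?thesis using u(1) same[of "lead_coeff q" c] coeff_polys_over[OF q(1)] by simp
      qed
      \<comment> \<open>This exhibits \<open>t\<close> as an element of
        \<open>A[b] \<inter> P\<close>, where \<open>van\<close> applies.\<close>
      have t: "t = poly ([:w:] - p * s) b" using st(3) by simp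
      have "\<phi> c t = 0" unfolding t
        by (rule van) (use t st in \<open>auto intro!: subring_diff[OF AX] subring_mult[OF AX] p
            const_in_polys_over subring_zero[OF A]\<close>, use w in blast)
      then have "\<phi> c w = \<phi> c (poly p b) * \<phi> c (poly s b)"
        by (simp add: st(3) ring_hom_simps[OF hom])
      then have "\<phi> c (poly p b) \<noteq> 0" using u(2) same[of w c] w by auto
      then show "\<exists>c. \<phi> c (poly p b) \<noteq> 0 \<and>
          (\<forall>g\<in>polys_over A. poly g b \<in> P \<longrightarrow> \<phi> c (poly g b) = 0)" using van by blast
    qed
  qed
qed

section \<open>Prime ideals, linear dependence and cardinality\<close>

text \<open>Zorn's lemma. By maximality, adjoining any \<open>h\<close> outside \<open>P\<close>
  captures a power of \<open>f\<close>. The exponent 0 counts among the avoided powers, which makes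
  \<open>P\<close> proper.\<close>

lemma ex_maximal_ideal_avoiding_powers:
  assumes I: "is_ideal I" and f: "\<And>r. f ^ r \<notin> I"
  obtains P where "I \<subseteq> P" "is_prime_ideal P" "f \<notin> P" "\<And>h. h \<notin> P \<Longrightarrow> \<exists>g r. f ^ r - g * h \<in> P"
proof -
  define T where "T = {J. is_ideal J \<and> I \<subseteq> J \<and> (\<forall>r. f ^ r \<notin> J)}"
  have "\<exists>P\<in>T. \<forall>X\<in>T. P \<subseteq> X \<longrightarrow> X = P"
  proof (rule subset_Zorn_nonempty)
    show "T \<noteq> {}" using assms by (auto simp: T_def)
    fix C assume C: "C \<noteq> {}" "subset.chain T C"
    then have CT: "\<And>J. J \<in> C \<Longrightarrow> J \<in> T" and lin: "\<And>J K. J \<in> C \<Longrightarrow> K \<in> C \<Longrightarrow> J \<subseteq> K \<or> K \<subseteq> J"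
      by (auto simp: subset_chain_def)
    have Ci: "\<And>J. J \<in> C \<Longrightarrow> is_ideal J" using CT by (auto simp: T_def)
    have "is_ideal (\<Union>C)"
      unfolding is_ideal_def
    proof (intro conjI ballI allI)
      show "0 \<in> \<Union>C" using C Ci ideal_zero by blast
      fix a b assume "a \<in> \<Union>C" "b \<in> \<Union>C"
      then obtain J where "J \<in> C" "a \<in> J" "b \<in> J" using lin by blast
      then show "a + b \<in> \<Union>C" using Ci[of J] ideal_add[of J a b] by blast
    next
      fix r a assume "a \<in> \<Union>C"
      then show "r * a \<in> \<Union>C" using Ci ideal_mult_left by blast
    qed
    then show "\<Union>C \<in> T" using C CT by (fastforce simp: T_def)
  qed
  then obtain P where PT: "P \<in> T" and max: "\<And>X. X \<in> T \<Longrightarrow> P \<subseteq> X \<Longrightarrow> X = P" by blast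
  have Pi: "is_ideal P" and fP: "\<And>r. f ^ r \<notin> P" using PT by (auto simp: T_def)
  have ext: "\<exists>g r. f ^ r - g * h \<in> P" if "h \<notin> P" for h
  proof -
    define X where "X = {p + g * h | p g. p \<in> P}"
    have XI: "p + g * h \<in> X" if "p \<in> P" for p g using that by (auto simp: X_def)
    have "is_ideal X"
      unfolding is_ideal_def
    proof (intro conjI ballI allI)
      show "0 \<in> X" using XI[OF ideal_zero[OF Pi], of 0] by simp
      fix a b assume "a \<in> X" "b \<in> X"
      then obtain p g p' g' where "p \<in> P" "p' \<in> P" "a = p + g * h" "b = p' + g' * h"
        by (auto simp: X_def)
      then show "a + b \<in> X" using XI[OF ideal_add[OF Pi], of p p' "g + g'"] by (simp add: algebra_simps)
    next
      fix r a assume "a \<in> X"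
      then obtain p g where "p \<in> P" "a = p + g * h" by (auto simp: X_def)
      then show "r * a \<in> X" using XI[OF ideal_mult_left[OF Pi], of p r "r * g"]
        by (simp add: algebra_simps)
    qed
    moreover have "P \<subseteq> X" using XI[of _ 0] by auto
    moreover have "h \<in> X" using XI[OF ideal_zero[OF Pi], of 1] by simp
    ultimately have "X \<notin> T" using max that by blast
    then obtain r where "f ^ r \<in> X" using \<open>is_ideal X\<close> \<open>P \<subseteq> X\<close> PT by (auto simp: T_def)
    then obtain p g where "p \<in> P" "f ^ r = p + g * h" by (auto simp: X_def)
    then have "f ^ r - g * h \<in> P" by simp
    then show ?thesis by blast
  qed
  have "is_prime_ideal P"
    unfolding is_prime_ideal_def
  proof (intro conjI allI impI Pi)
    show "1 \<notin> P" using fP[of 0] by simp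
    fix a b assume ab: "a * b \<in> P"
    show "a \<in> P \<or> b \<in> P"
    proof (rule ccontr)
      assume "\<not> (a \<in> P \<or> b \<in> P)"
      then obtain g r g' r' where g: "f ^ r - g * a \<in> P" "f ^ r' - g' * b \<in> P" using ext by metis
      \<comment> \<open>Multiplying the two congruences expresses \<open>f ^ (r + r')\<close>
        through elements of \<open>P\<close>.\<close>
      have "(f ^ r - g * a) * f ^ r' + ((f ^ r' - g' * b) * (g * a) + (a * b) * (g * g')) \<in> P"
        by (intro ideal_add[OF Pi] ideal_mult_right[OF Pi] g ab)
      also have "(f ^ r - g * a) * f ^ r' + ((f ^ r' - g' * b) * (g * a) + (a * b) * (g * g')) = f ^ (r + r')"
        by (simp add: algebra_simps power_add)
      finally show False using fP by blast
    qed
  qed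
  moreover have "f \<notin> P" using fP[of 1] by simp
  ultimately show ?thesis using that PT ext by (auto simp: T_def)
qed

section \<open>Linear dependence of more vectors than coordinates\<close>

text \<open>Gaussian elimination, one coordinate per induction step, with \<open>g a\<close> read as
  a vector indexed by \<open>S\<close>.\<close>

lemma ex_linear_dependence:
  fixes g :: "'a \<Rightarrow> 's \<Rightarrow> 'k::field"
  assumes "finite S" "finite T" "card S < card T"
  shows "\<exists>c. (\<exists>a\<in>T. c a \<noteq> 0) \<and> (\<forall>s\<in>S. (\<Sum>a\<in>T. c a * g a s) = 0)"
  using assms
proof (induction S arbitrary: T g rule: finite_induct)
  case empty
  then have "T \<noteq> {}" by auto
  then show ?case by (intro exI[of _ "\<lambda>_. 1"]) auto
next
  case (insert s S)
  show ?case
  proof (cases "\<forall>a\<in>T. g a s = 0")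
    case True
    with insert.IH[of T g] insert.prems insert.hyps show ?thesis by auto
  next
    case False
    then obtain a0 where a0: "a0 \<in> T" "g a0 s \<noteq> 0" by blast
    let ?T = "T - {a0}"
    have "card S < card ?T" using insert a0 by simp
    \<comment> \<open>Subtracting multiples of the pivot vector \<open>g a0\<close> clears
      coordinate \<open>s\<close>; \<open>d\<close> then collects these multiples in the coefficient
      of \<open>a0\<close>.\<close>
    from insert.IH[OF _ this, of "\<lambda>a t. g a t - g a s / g a0 s * g a0 t"] insert.prems
    obtain c where c: "\<exists>a\<in>?T. c a \<noteq> 0"
      "\<forall>t\<in>S. (\<Sum>a\<in>?T. c a * (g a t - g a s / g a0 s * g a0 t)) = 0" by auto
    define d where "d = (\<lambda>a. if a = a0 then - (\<Sum>a\<in>?T. c a * (g a s / g a0 s)) else c a)"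
    have "(\<Sum>a\<in>T. d a * g a t) = (\<Sum>a\<in>?T. c a * (g a t - g a s / g a0 s * g a0 t))" for t
    proof -
      have "(\<Sum>a\<in>T. d a * g a t) = d a0 * g a0 t + (\<Sum>a\<in>?T. d a * g a t)"
        using a0 insert.prems by (intro sum.remove)
      also have "(\<Sum>a\<in>?T. d a * g a t) = (\<Sum>a\<in>?T. c a * g a t)"
        by (intro sum.cong) (auto simp: d_def)
      also have "d a0 * g a0 t = - (\<Sum>a\<in>?T. c a * (g a s / g a0 s * g a0 t))"
        by (simp add: d_def sum_distrib_right mult.assoc)
      finally show ?thesis by (simp add: sum_subtractf right_diff_distrib)
    qed
    then have "\<forall>t\<in>insert s S. (\<Sum>a\<in>T. d a * g a t) = 0" using c(2) a0 by auto
    moreover have "\<exists>a\<in>T. d a \<noteq> 0" using c(1) by (auto simp: d_def)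
    ultimately show ?thesis by blast
  qed
qed

section \<open>Pigeonhole principle and the number of monomials\<close>

text \<open>If all fibres were finite, the domain would be a union of at most \<open>|C|\<close>
  finite sets and hence no larger than \<open>C\<close>.\<close>

lemma infinite_fibre:
  fixes h :: "'a \<Rightarrow> 'b"
  assumes "range h \<lesssim> C" "infinite C" "C \<prec> (UNIV :: 'a set)"
  shows "\<exists>t. infinite {a. h a = t}"
proof (rule ccontr)
  assume "\<nexists>t. infinite {a. h a = t}"
  then have fin: "finite {a. h a = t}" for t by blast
  have "|range h| \<le>o |C|" using assms(1) by (simp add: lepoll_def card_of_ordLeq)
  moreover have "\<forall>t\<in>range h. |{a. h a = t}| \<le>o |C|"
    using fin assms(2) ordLess_imp_ordLeq finite_ordLess_infinite2 by blast
  ultimately have "|\<Union>t\<in>range h. {a. h a = t}| \<le>o |C|"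
    by (rule card_of_UNION_ordLeq_infinite[OF assms(2)])
  moreover have "(\<Union>t\<in>range h. {a. h a = t}) = UNIV" by auto
  ultimately have "(UNIV :: 'a set) \<lesssim> C"
    by (metis card_of_ordLeq lepoll_def)
  then show False using assms(3) lepoll_antisym lesspoll_def by blast
qed

lemma lepoll_times_self: "infinite A \<Longrightarrow> A \<times> A \<lesssim> A"
  using card_of_Times_same_infinite[of A] eqpoll_iff_card_of_ordIso eqpoll_imp_lepoll by blast

lemma times_nat_lepoll:
  assumes "infinite (UNIV :: 'v set)"
  shows "(UNIV :: ('v \<times> nat) set) \<lesssim> (UNIV :: 'v set)"
proof -
  have "(UNIV :: ('v \<times> nat) set) = UNIV \<times> UNIV" by simp
  also have "\<dots> \<lesssim> (UNIV :: 'v set) \<times> (UNIV :: 'v set)"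
    using assms infinite_le_lepoll by (intro times_lepoll_mono) auto
  also have "\<dots> \<lesssim> (UNIV :: 'v set)" by (rule lepoll_times_self[OF assms])
  finally show ?thesis .
qed

lemma Fpow_lepoll_mono: "A \<lesssim> B \<Longrightarrow> Fpow A \<lesssim> Fpow B"
  unfolding lepoll_def' Fpow_def by (force intro: inj_on_image_Fpow[unfolded Fpow_def])

text \<open>A monomial is encoded by the graph of its exponents on its support, a finite subset of
  \<open>'v \<times> nat\<close>; an infinite set has as many finite subsets as elements.\<close>

lemma monomials_lepoll:
  assumes "infinite (UNIV :: 'v set)"
  shows "(UNIV :: ('v \<Rightarrow>\<^sub>0 nat) set) \<lesssim> (UNIV :: 'v set)"
proof -
  let ?G = "\<lambda>t :: 'v \<Rightarrow>\<^sub>0 nat. (\<lambda>v. (v, Poly_Mapping.lookup t v)) ` Poly_Mapping.keys t"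
  have "inj ?G"
  proof (rule injI)
    fix s t assume eq: "?G s = ?G t"
    show "s = t"
    proof (rule poly_mapping_eqI)
      fix v
      have "v \<in> Poly_Mapping.keys s \<longleftrightarrow> v \<in> Poly_Mapping.keys t" using eq by (auto simp: set_eq_iff image_iff)
      moreover have "Poly_Mapping.lookup s v = Poly_Mapping.lookup t v" if "v \<in> Poly_Mapping.keys s"
      proof -
        have "(v, Poly_Mapping.lookup s v) \<in> ?G t" using that eq by (metis imageI)
        then show ?thesis by auto
      qed
      ultimately show "Poly_Mapping.lookup s v = Poly_Mapping.lookup t v"
        by (metis in_keys_iff)
    qed
  qed
  moreover have "range ?G \<subseteq> Fpow UNIV" by (auto simp: Fpow_def)
  ultimately have "(UNIV :: ('v \<Rightarrow>\<^sub>0 nat) set) \<lesssim> Fpow (UNIV :: ('v \<times> nat) set)"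
    unfolding lepoll_def by blast
  also have "\<dots> \<lesssim> Fpow (UNIV :: 'v set)" by (rule Fpow_lepoll_mono[OF times_nat_lepoll[OF assms]])
  also have "\<dots> \<lesssim> (UNIV :: 'v set)" using eqpoll_Fpow[OF assms] eqpoll_imp_lepoll by blast
  finally show ?thesis .
qed

text \<open>Counts the pairs of a polynomial's support and an exponent of \<open>f\<close>, for the
  pigeonhole argument on inverses.\<close>

lemma monomial_sets_lepoll:
  assumes "infinite (UNIV :: 'v set)"
  shows "Fpow (UNIV :: ('v \<Rightarrow>\<^sub>0 nat) set) \<times> (UNIV :: nat set) \<lesssim> (UNIV :: 'v set)"
proof -
  have "Fpow (UNIV :: ('v \<Rightarrow>\<^sub>0 nat) set) \<lesssim> Fpow (UNIV :: 'v set)"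
    by (rule Fpow_lepoll_mono[OF monomials_lepoll[OF assms]])
  also have "\<dots> \<lesssim> (UNIV :: 'v set)" using eqpoll_Fpow[OF assms] eqpoll_imp_lepoll by blast
  finally have "Fpow (UNIV :: ('v \<Rightarrow>\<^sub>0 nat) set) \<times> (UNIV :: nat set) \<lesssim> (UNIV :: 'v set) \<times> (UNIV :: nat set)"
    by (intro times_lepoll_mono) auto
  also have "\<dots> \<lesssim> (UNIV :: 'v set)" using times_nat_lepoll[OF assms] by simp
  finally show ?thesis .
qed

section \<open>The Nullstellensatz\<close>

definition mp_const :: "'k::comm_ring_1 \<Rightarrow> ('v \<Rightarrow>\<^sub>0 nat) \<Rightarrow>\<^sub>0 'k" where
  "mp_const c = Poly_Mapping.single 0 c"

definition mp_var :: "'v \<Rightarrow> ('v \<Rightarrow>\<^sub>0 nat) \<Rightarrow>\<^sub>0 'k::comm_ring_1" where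
  "mp_var v = Poly_Mapping.single (Poly_Mapping.single v 1) 1"

definition mp_eval :: "('v \<Rightarrow> 'k) \<Rightarrow> (('v \<Rightarrow>\<^sub>0 nat) \<Rightarrow>\<^sub>0 'k::comm_ring_1) \<Rightarrow> 'k" where
  "mp_eval = poly_subst (\<lambda>c. c)"

lemma is_ring_hom_mp_const: "is_ring_hom mp_const"
  by (simp add: is_ring_hom_def mp_const_def single_add mult_single)

lemma is_ring_hom_ident: "is_ring_hom (\<lambda>c. c)"
  by (simp add: is_ring_hom_def)

lemma is_ring_hom_mp_eval: "is_ring_hom (mp_eval \<xi>)"
  unfolding mp_eval_def by (rule is_ring_hom_poly_subst[OF is_ring_hom_ident])

lemma mp_eval_const [simp]: "mp_eval \<xi> (mp_const c) = c"
  by (simp add: mp_eval_def mp_const_def poly_subst_single[OF is_ring_hom_ident])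

lemma mp_eval_var [simp]: "mp_eval \<xi> (mp_var v) = \<xi> v"
  by (simp add: mp_eval_def mp_var_def poly_subst_single[OF is_ring_hom_ident])

text \<open>Serves as an induction principle when \<open>A\<close> is the set of polynomials with a
  desired property.\<close>

lemma mpoly_in_subring:
  assumes A: "is_subring A" and const: "\<And>c. mp_const c \<in> A" and var: "\<And>v. mp_var v \<in> A"
  shows "p \<in> A"
proof -
  have pow: "Poly_Mapping.single (Poly_Mapping.single v k) 1 \<in> A" for v k
  proof (induction k)
    case 0
    show ?case using subring_one[OF A] by simp
  next
    case (Suc k)
    have "Poly_Mapping.single (Poly_Mapping.single v (Suc k)) 1 =
        mp_var v * Poly_Mapping.single (Poly_Mapping.single v k) (1 :: 'b)"
      by (simp add: mp_var_def mult_single single_add[symmetric])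
    then show ?case using subring_mult[OF A var Suc] by simp
  qed
  have mono: "Poly_Mapping.single t 1 \<in> A" for t
  proof (induction t rule: poly_mapping_single_induct)
    case 1
    show ?case using subring_one[OF A] by simp
  next
    case (2 t v k)
    have "Poly_Mapping.single (t + Poly_Mapping.single v k) 1 =
        Poly_Mapping.single t 1 * Poly_Mapping.single (Poly_Mapping.single v k) (1 :: 'b)"
      by (simp add: mult_single)
    then show ?case using subring_mult[OF A 2 pow] by simp
  qed
  show ?thesis
  proof (induction p rule: poly_mapping_single_induct)
    case 1
    show ?case by (rule subring_zero[OF A])
  next
    case (2 p t a)
    have "Poly_Mapping.single t a = mp_const a * Poly_Mapping.single t 1"
      by (simp add: mp_const_def mult_single)
    then show ?case using subring_add[OF A 2] subring_mult[OF A const mono] by simp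
  qed
qed

lemma lookup_mp_const_mult: "Poly_Mapping.lookup (mp_const c * p) t = c * Poly_Mapping.lookup p t"
proof (induction p rule: poly_mapping_single_induct)
  case (2 p s a)
  then show ?case
    by (simp add: mp_const_def distrib_left lookup_add mult_single lookup_single when_def)
qed simp

section \<open>Zeros of prime ideals in infinitely many indeterminates\<close>

lemma is_ring_hom_poly_map_poly:
  assumes "is_ring_hom h"
  shows "is_ring_hom (\<lambda>p. poly (map_poly h p) x)"
proof -
  note h = ring_hom_simps[OF assms]
  have "map_poly h (p + q) = map_poly h p + map_poly h q" for p q
    by (rule poly_eqI) (simp add: coeff_map_poly h)
  moreover have "map_poly h (p * q) = map_poly h p * map_poly h q" for p q
    by (rule poly_eqI) (simp add: coeff_map_poly h coeff_mult ring_hom_sum[OF assms])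
  ultimately show ?thesis by (simp add: is_ring_hom_def h)
qed

lemma ring_hom_prod: "is_ring_hom h \<Longrightarrow> h (prod g S) = (\<Prod>x\<in>S. h (g x))"
  by (induction S rule: infinite_finite_induct) (simp_all add: ring_hom_simps)

text \<open>\<open>H\<close> splits into linear factors, and primality puts one of them into
  \<open>P\<close>; a nonzero constant is a unit and cannot lie in \<open>P\<close>.\<close>

lemma prime_ideal_mem_imp_root:
  fixes H :: "'k::alg_closed_field poly"
  assumes P: "is_prime_ideal P" and h: "is_ring_hom h" and H: "H \<noteq> 0"
    and mem: "poly (map_poly h H) x \<in> P"
  shows "\<exists>a. x - h a \<in> P"
  using H mem
proof (induction "degree H" arbitrary: H)
  case 0
  then obtain c where c: "H = [:c:]" "c \<noteq> 0" using degree_eq_zeroE by (metis pCons_eq_0_iff)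
  then have "h c \<in> P" using 0 by (simp add: map_poly_pCons ring_hom_simps[OF h])
  then have "h (1 / c) * h c \<in> P" using P ideal_mult_left unfolding is_prime_ideal_def by blast
  then have "1 \<in> P" using c by (simp flip: ring_hom_simps(4)[OF h] add: ring_hom_simps(2)[OF h])
  then show ?case using P by (simp add: is_prime_ideal_def)
next
  case (Suc n)
  obtain a where a: "poly H a = 0" using alg_closed_imp_poly_has_root[of H] Suc by auto
  then obtain K where K: "H = [:-a, 1:] * K" by (auto simp: poly_eq_0_iff_dvd)
  note E = ring_hom_simps[OF is_ring_hom_poly_map_poly[OF h]]
  have "poly (map_poly h H) x = (x - h a) * poly (map_poly h K) x"
    unfolding K E by (simp add: map_poly_pCons ring_hom_simps[OF h])
  then have "x - h a \<in> P \<or> poly (map_poly h K) x \<in> P"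
    using P Suc.prems by (auto simp: is_prime_ideal_def)
  moreover have "K \<noteq> 0" using K Suc.prems by auto
  moreover from this have "degree H = Suc (degree K)" unfolding K by (subst degree_mult_eq) auto
  ultimately show ?case using Suc by auto
qed

text \<open>If no \<open>X\<^sub>v - a\<close> lies in \<open>P\<close>, then each has an inverse \<open>G a\<close> modulo \<open>P\<close> up to a power of
  \<open>f\<close>. By cardinality, more of the \<open>G a\<close> than they have monomials share both the support and that
  power, so they are linearly dependent. Clearing denominators in the dependence
  \<open>\<Sum> c\<^sub>a / (X\<^sub>v - a) = 0\<close> yields a nonzero univariate polynomial in \<open>X\<^sub>v\<close> that lies in \<open>P\<close>.\<close>

lemma ex_var_minus_const_mem:
  fixes P :: "(('v \<Rightarrow>\<^sub>0 nat) \<Rightarrow>\<^sub>0 'k::alg_closed_field) set"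
  assumes P: "is_prime_ideal P" and fP: "f \<notin> P"
    and inv: "\<And>h. h \<notin> P \<Longrightarrow> \<exists>g r. f ^ r - g * h \<in> P"
    and inf: "infinite (UNIV :: 'v set)" and less: "(UNIV :: 'v set) \<prec> (UNIV :: 'k set)"
  shows "\<exists>a. mp_var v - mp_const a \<in> P"
proof (rule ccontr)
  assume none: "\<nexists>a. mp_var v - mp_const a \<in> P"
  have Pi: "is_ideal P" using P by (simp add: is_prime_ideal_def)
  let ?x = "mp_var v :: ('v \<Rightarrow>\<^sub>0 nat) \<Rightarrow>\<^sub>0 'k"
  let ?L = "\<lambda>a. ?x - mp_const a"
  have "\<forall>a. \<exists>g r. f ^ r - g * ?L a \<in> P" using inv none by blast
  then obtain G r where Gr: "\<And>a. f ^ r a - G a * ?L a \<in> P" by metis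
  \<comment> \<open>The coefficients of \<open>G a\<close> are left out, as they range over
    \<open>k\<close>; supports and exponents are few by comparison.\<close>
  define h where "h = (\<lambda>a. (Poly_Mapping.keys (G a), r a))"
  have "range h \<subseteq> Fpow UNIV \<times> UNIV" by (auto simp: h_def Fpow_def)
  then have "range h \<lesssim> (UNIV :: 'v set)"
    using monomial_sets_lepoll[OF inf] subset_imp_lepoll lepoll_trans by blast
  then obtain t where t: "infinite {a. h a = t}" using infinite_fibre[OF _ inf less] by blast
  obtain S n where Sn: "t = (S, n)" by (cases t)
  obtain T where T: "finite T" "card T = Suc (card S)" "T \<subseteq> {a. h a = t}"
    using infinite_arbitrarily_large[OF t] by metis
  have GT: "Poly_Mapping.keys (G a) = S" "r a = n" if "a \<in> T" for a
    using that T(3) by (auto simp: h_def Sn)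
  have "T \<noteq> {}" using T(2) by auto
  then have finS: "finite S" using GT by (metis all_not_in_conv finite_keys)
  obtain c where c: "\<exists>a\<in>T. c a \<noteq> 0" "\<forall>s\<in>S. (\<Sum>a\<in>T. c a * Poly_Mapping.lookup (G a) s) = 0"
    using ex_linear_dependence[OF finS T(1), of "\<lambda>a. Poly_Mapping.lookup (G a)"] T(2) by auto
  have dep: "(\<Sum>a\<in>T. mp_const (c a) * G a) = 0"
  proof (rule poly_mapping_eqI)
    fix s
    have "(\<Sum>a\<in>T. c a * Poly_Mapping.lookup (G a) s) = 0"
    proof (cases "s \<in> S")
      case False
      then show ?thesis by (intro sum.neutral ballI) (metis GT(1) in_keys_iff mult_zero_right)
    qed (use c in blast)
    then show "Poly_Mapping.lookup (\<Sum>a\<in>T. mp_const (c a) * G a) s = Poly_Mapping.lookup 0 s"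
      by (simp add: lookup_sum lookup_mp_const_mult)
  qed
  define Q where "Q = (\<lambda>a. \<Prod>b\<in>T - {a}. ?L b)"
  have Q: "prod ?L T = ?L a * Q a" if "a \<in> T" for a
    unfolding Q_def using that T(1) by (intro prod.remove)
  \<comment> \<open>Multiplication by \<open>Q a\<close> turns \<open>?L a\<close> into the common
    factor \<open>prod ?L T\<close>, so that \<open>dep\<close> removes the terms with
    \<open>G a\<close>.\<close>
  have "(\<Sum>a\<in>T. mp_const (c a) * Q a * (f ^ r a - G a * ?L a)) \<in> P"
    by (intro ideal_sum[OF Pi] ideal_mult_left[OF Pi] Gr)
  also have "(\<Sum>a\<in>T. mp_const (c a) * Q a * (f ^ r a - G a * ?L a)) =
      (\<Sum>a\<in>T. f ^ n * (mp_const (c a) * Q a) - prod ?L T * (mp_const (c a) * G a))"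
    by (intro sum.cong) (auto simp: Q GT algebra_simps)
  also have "\<dots> = f ^ n * (\<Sum>a\<in>T. mp_const (c a) * Q a)"
    by (simp add: sum_subtractf dep flip: sum_distrib_left)
  finally have mem: "(\<Sum>a\<in>T. mp_const (c a) * Q a) \<in> P"
    using P fP prime_ideal_power[OF P] unfolding is_prime_ideal_def by blast
  define H where "H = (\<Sum>a\<in>T. [:c a:] * (\<Prod>b\<in>T - {a}. [:-b, 1:]))"
  note E = is_ring_hom_poly_map_poly[OF is_ring_hom_mp_const, of ?x]
  have "poly (map_poly mp_const H) ?x = (\<Sum>a\<in>T. mp_const (c a) * Q a)"
    unfolding H_def Q_def ring_hom_sum[OF E] ring_hom_simps(4)[OF E] ring_hom_prod[OF E]
    by (simp add: map_poly_pCons ring_hom_simps[OF is_ring_hom_mp_const])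
  moreover have "H \<noteq> 0"
  proof
    assume "H = 0"
    obtain a where a: "a \<in> T" "c a \<noteq> 0" using c by blast
    \<comment> \<open>At \<open>a\<close> only the summand of \<open>a\<close> survives:
      \<open>c a\<close> times a product of nonzero differences.\<close>
    have "poly H a = (\<Sum>a'\<in>T. c a' * (\<Prod>b\<in>T - {a'}. a - b))"
      by (simp add: H_def poly_sum poly_prod)
    also have "\<dots> = c a * (\<Prod>b\<in>T - {a}. a - b) + (\<Sum>a'\<in>T - {a}. c a' * (\<Prod>b\<in>T - {a'}. a - b))"
      using a T(1) by (intro sum.remove)
    also have "(\<Sum>a'\<in>T - {a}. c a' * (\<Prod>b\<in>T - {a'}. a - b)) = 0"
      using a T(1) by (intro sum.neutral ballI) auto
    finally show False using \<open>H = 0\<close> a T(1) by (auto simp: prod_zero_iff)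
  qed
  ultimately show False
    using prime_ideal_mem_imp_root[OF P is_ring_hom_mp_const, of H ?x] mem none by simp
qed

text \<open>Once every indeterminate is congruent to a constant \<open>\<xi> v\<close>, reduction
  modulo \<open>P\<close> is evaluation at \<open>\<xi>\<close>.\<close>

lemma prime_ideal_zero_infinite:
  fixes P :: "(('v \<Rightarrow>\<^sub>0 nat) \<Rightarrow>\<^sub>0 'k::alg_closed_field) set"
  assumes P: "is_prime_ideal P" and fP: "f \<notin> P"
    and inv: "\<And>h. h \<notin> P \<Longrightarrow> \<exists>g r. f ^ r - g * h \<in> P"
    and inf: "infinite (UNIV :: 'v set)" and less: "(UNIV :: 'v set) \<prec> (UNIV :: 'k set)"
  shows "\<exists>\<xi>. mp_eval \<xi> f \<noteq> 0 \<and> (\<forall>g\<in>P. mp_eval \<xi> g = 0)"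
proof -
  have Pi: "is_ideal P" using P by (simp add: is_prime_ideal_def)
  note C = ring_hom_simps[OF is_ring_hom_mp_const] and ev = ring_hom_simps[OF is_ring_hom_mp_eval]
  obtain \<xi> where \<xi>: "\<And>v. mp_var v - mp_const (\<xi> v) \<in> P"
    using ex_var_minus_const_mem[OF P fP inv inf less] by metis
  let ?A = "{p. p - mp_const (mp_eval \<xi> p) \<in> P}"
  have "is_subring ?A"
    unfolding is_subring_def
  proof (intro conjI ballI)
    show "1 \<in> ?A" using ideal_zero[OF Pi] by (simp add: ev C)
    fix a assume "a \<in> ?A"
    then have a: "a - mp_const (mp_eval \<xi> a) \<in> P" by simp
    show "- a \<in> ?A" using ideal_uminus[OF Pi a] by (simp add: ev C)
    fix b assume "b \<in> ?A"
    then have b: "b - mp_const (mp_eval \<xi> b) \<in> P" by simp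
    show "a + b \<in> ?A" using ideal_add[OF Pi a b] by (simp add: ev C algebra_simps)
    show "a * b \<in> ?A"
      using ideal_add[OF Pi ideal_mult_left[OF Pi b, of a]
          ideal_mult_left[OF Pi a, of "mp_const (mp_eval \<xi> b)"]]
      by (simp add: ev C algebra_simps)
  qed
  then have "p \<in> ?A" for p
    by (rule mpoly_in_subring) (use \<xi> ideal_zero[OF Pi] in auto)
  then have red: "p - mp_const (mp_eval \<xi> p) \<in> P" for p by simp
  have "mp_eval \<xi> g = 0" if "g \<in> P" for g
  proof (rule ccontr)
    assume nz: "mp_eval \<xi> g \<noteq> 0"
    have "mp_const (mp_eval \<xi> g) \<in> P" using ideal_diff[OF Pi that red[of g]] by simp
    then have "mp_const (1 / mp_eval \<xi> g) * mp_const (mp_eval \<xi> g) \<in> P" by (rule ideal_mult_left[OF Pi])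
    then have "1 \<in> P" using nz by (simp flip: C(4) add: C(2))
    then show False using P by (simp add: is_prime_ideal_def)
  qed
  moreover have "mp_eval \<xi> f \<noteq> 0" using red[of f] fP by (auto simp: C)
  ultimately show ?thesis by blast
qed

section \<open>Zeros of prime ideals in finitely many indeterminates\<close>

text \<open>Induction on \<open>V\<close>, with \<open>A\<close> the polynomials in the
  indeterminates from \<open>V\<close>. The clause on \<open>\<xi>\<close> and \<open>\<xi>'\<close>
  lets a new coordinate vary without affecting \<open>A\<close>, which supplies the family of
  extensions.\<close>

lemma ex_subring_with_zeros:
  fixes P :: "(('v \<Rightarrow>\<^sub>0 nat) \<Rightarrow>\<^sub>0 'k::alg_closed_field) set"
  assumes P: "is_prime_ideal P" and "finite V"
  shows "\<exists>A. is_subring A \<and> range mp_const \<subseteq> A \<and> mp_var ` V \<subseteq> A \<and>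
    (\<forall>p\<in>A. \<forall>\<xi> \<xi>'. (\<forall>v\<in>V. \<xi> v = \<xi>' v) \<longrightarrow> mp_eval \<xi> p = mp_eval \<xi>' p) \<and>
    (\<forall>f\<in>A - P. \<exists>\<xi>. mp_eval \<xi> f \<noteq> 0 \<and> (\<forall>g\<in>A \<inter> P. mp_eval \<xi> g = 0))"
  using assms(2)
proof (induction V rule: finite_induct)
  case empty
  have Pi: "is_ideal P" using P by (simp add: is_prime_ideal_def)
  let ?C = "mp_const :: 'k \<Rightarrow> ('v \<Rightarrow>\<^sub>0 nat) \<Rightarrow>\<^sub>0 'k"
  note C = ring_hom_simps[OF is_ring_hom_mp_const]
  have "is_subring (range ?C)"
    unfolding is_subring_def by (auto simp flip: C(2-5))
  \<comment> \<open>A nonzero constant is a unit, so \<open>P\<close> contains none and every point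
    is a zero of the intersection.\<close>
  moreover have "d = 0" if "?C d \<in> P" for d
  proof (rule ccontr)
    assume "d \<noteq> 0"
    moreover have "?C (1 / d) * ?C d \<in> P" by (rule ideal_mult_left[OF Pi that])
    ultimately have "1 \<in> P" by (simp flip: C(4) add: C(2))
    then show False using P by (simp add: is_prime_ideal_def)
  qed
  moreover have "?C 0 \<in> P" using ideal_zero[OF Pi] by (simp add: C)
  ultimately show ?case by (intro exI[of _ "range ?C"]) auto
next
  case (insert v V)
  obtain A where A: "is_subring A" and const: "range mp_const \<subseteq> A" and var: "mp_var ` V \<subseteq> A"
    and dep: "\<And>p \<xi> \<xi>'. p \<in> A \<Longrightarrow> (\<And>v. v \<in> V \<Longrightarrow> \<xi> v = \<xi>' v) \<Longrightarrow> mp_eval \<xi> p = mp_eval \<xi>' p"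
    and zeros: "\<And>f. f \<in> A - P \<Longrightarrow> \<exists>\<xi>. mp_eval \<xi> f \<noteq> 0 \<and> (\<forall>g\<in>A \<inter> P. mp_eval \<xi> g = 0)"
    using insert.IH by metis
  note AX = is_subring_polys_over[OF A] and ev = ring_hom_simps[OF is_ring_hom_mp_eval]
  let ?x = "mp_var v :: ('v \<Rightarrow>\<^sub>0 nat) \<Rightarrow>\<^sub>0 'k"
  define B where "B = (\<lambda>p. poly p ?x) ` polys_over A"
  have BI: "poly p ?x \<in> B" if "p \<in> polys_over A" for p using that by (simp add: B_def)
  have "is_subring B"
    unfolding is_subring_def
  proof (intro conjI ballI)
    show "1 \<in> B" using BI[OF subring_one[OF AX]] by simp
    fix a assume "a \<in> B"
    then obtain p where p: "p \<in> polys_over A" "a = poly p ?x" by (auto simp: B_def)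
    show "- a \<in> B" using BI[OF subring_uminus[OF AX p(1)]] p by simp
    fix b assume "b \<in> B"
    then obtain q where q: "q \<in> polys_over A" "b = poly q ?x" by (auto simp: B_def)
    show "a + b \<in> B" "a * b \<in> B"
      using BI[OF subring_add[OF AX p(1) q(1)]] BI[OF subring_mult[OF AX p(1) q(1)]] p q by simp_all
  qed
  moreover have AB: "a \<in> B" if "a \<in> A" for a
    using BI[OF const_in_polys_over[OF subring_zero[OF A] that]] by simp
  then have "range mp_const \<subseteq> B" "mp_var ` V \<subseteq> B" using const var by auto
  moreover have "?x \<in> B"
    using BI[OF monom_in_polys_over[OF subring_zero[OF A] subring_one[OF A]], of 1] by (simp add: poly_monom)
  moreover have "mp_eval \<xi> p = mp_eval \<xi>' p" if p: "p \<in> B" and eq: "\<forall>w\<in>insert v V. \<xi> w = \<xi>' w" for p \<xi> \<xi>'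
  proof -
    obtain q where q: "q \<in> polys_over A" "p = poly q ?x" using p by (auto simp: B_def)
    have "mp_eval \<xi> (coeff q i) = mp_eval \<xi>' (coeff q i)" for i
      using eq by (intro dep coeff_polys_over[OF q(1)]) auto
    then show ?thesis
      using eq by (simp add: q poly_altdef ring_hom_sum[OF is_ring_hom_mp_eval] ev)
  qed
  moreover have "\<exists>\<xi>. mp_eval \<xi> f \<noteq> 0 \<and> (\<forall>g\<in>B \<inter> P. mp_eval \<xi> g = 0)" if f: "f \<in> B - P" for f
  proof -
    obtain p where p: "p \<in> polys_over A" "f = poly p ?x" using f by (auto simp: B_def)
    then have fP: "poly p ?x \<notin> P" using f by simp
    \<comment> \<open>The induction hypothesis gives a point for \<open>u\<close>; its coordinate at
      \<open>v\<close> is then changed to the \<open>c\<close> found by the extension.\<close>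
    obtain u where u: "u \<in> A - P" and ext: "\<And>(\<phi> :: 'k \<Rightarrow> _ \<Rightarrow> 'k) \<phi>0.
      (\<forall>c. is_ring_hom (\<phi> c)) \<and> (\<forall>c. \<phi> c ?x = c) \<and> (\<forall>c. \<forall>a\<in>A. \<phi> c a = \<phi>0 a) \<and>
      (\<forall>a\<in>A \<inter> P. \<phi>0 a = 0) \<and> \<phi>0 u \<noteq> 0 \<Longrightarrow>
      \<exists>c. \<phi> c (poly p ?x) \<noteq> 0 \<and> (\<forall>g\<in>polys_over A. poly g ?x \<in> P \<longrightarrow> \<phi> c (poly g ?x) = 0)"
      using ring_hom_extension[OF A P p(1) fP] by blast
    obtain \<xi> where \<xi>: "mp_eval \<xi> u \<noteq> 0" "\<forall>g\<in>A \<inter> P. mp_eval \<xi> g = 0" using zeros[OF u] by blast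
    have "mp_eval (\<xi>(v := c)) a = mp_eval \<xi> a" if "a \<in> A" for a c
      using insert.hyps by (intro dep[OF that]) auto
    then have "\<exists>c. mp_eval (\<xi>(v := c)) (poly p ?x) \<noteq> 0 \<and>
        (\<forall>g\<in>polys_over A. poly g ?x \<in> P \<longrightarrow> mp_eval (\<xi>(v := c)) (poly g ?x) = 0)"
      using \<xi> by (intro ext[of "\<lambda>c. mp_eval (\<xi>(v := c))" "mp_eval \<xi>"]) (simp add: is_ring_hom_mp_eval)
    then obtain c where "mp_eval (\<xi>(v := c)) (poly p ?x) \<noteq> 0"
      "\<forall>g\<in>polys_over A. poly g ?x \<in> P \<longrightarrow> mp_eval (\<xi>(v := c)) (poly g ?x) = 0" by blast
    then show ?thesis using p by (intro exI[of _ "\<xi>(v := c)"]) (auto simp: B_def)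
  qed
  ultimately show ?case by (intro exI[of _ B]) simp
qed

text \<open>The Nullstellensatz in contrapositive form. A zero of the larger prime ideal
  \<open>P\<close> is a zero of \<open>I\<close>.\<close>

lemma nullstellensatz_point:
  fixes I :: "(('v \<Rightarrow>\<^sub>0 nat) \<Rightarrow>\<^sub>0 'k::alg_closed_field) set"
  assumes I: "is_ideal I" and f: "\<And>r. f ^ r \<notin> I"
    and size: "finite (UNIV :: 'v set) \<or> (UNIV :: 'v set) \<prec> (UNIV :: 'k set)"
  shows "\<exists>\<xi>. mp_eval \<xi> f \<noteq> 0 \<and> (\<forall>g\<in>I. mp_eval \<xi> g = 0)"
proof -
  obtain P where IP: "I \<subseteq> P" and P: "is_prime_ideal P" and fP: "f \<notin> P"
    and inv: "\<And>h. h \<notin> P \<Longrightarrow> \<exists>g r. f ^ r - g * h \<in> P"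
    using ex_maximal_ideal_avoiding_powers[OF I f] by blast
  have "\<exists>\<xi>. mp_eval \<xi> f \<noteq> 0 \<and> (\<forall>g\<in>P. mp_eval \<xi> g = 0)"
  proof (cases "finite (UNIV :: 'v set)")
    case True
    obtain A where A: "is_subring A" "range mp_const \<subseteq> A" "range mp_var \<subseteq> A"
      and zeros: "\<forall>f\<in>A - P. \<exists>\<xi>. mp_eval \<xi> f \<noteq> 0 \<and> (\<forall>g\<in>A \<inter> P. mp_eval \<xi> g = 0)"
      using ex_subring_with_zeros[OF P True] by auto
    have "A = UNIV" using mpoly_in_subring[OF A(1)] A(2,3) by blast
    then show ?thesis using zeros fP by auto
  next
    case False
    then show ?thesis using prime_ideal_zero_infinite[OF P fP inv] size by blast
  qed
  then show ?thesis using IP by blast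
qed

section \<open>Passage between tuples of sequences and points\<close>

text \<open>Both sides are ring homomorphisms in \<open>f\<close>, so constants and indeterminates
  decide. A tuple of sequences thus yields one point for each \<open>m\<close>.\<close>

lemma M_eval_at: "M_eval f x m = mp_eval (\<lambda>(m', i). x i (m * m')) f"
proof -
  have "(\<lambda>f. M_eval f x m) = mp_eval (\<lambda>(m', i). x i (m * m'))"
  proof (rule M_poly_hom_eqI)
    have "is_ring_hom (\<lambda>f. M_eval f x)"
      using M_eval_hom[of x] by (simp add: is_M_eval_hom_def is_M_ring_hom_def)
    then show "is_ring_hom (\<lambda>f. M_eval f x m)" by (simp add: is_ring_hom_def)
    show "is_ring_hom (mp_eval (\<lambda>(m', i). x i (m * m')))" by (rule is_ring_hom_mp_eval)
  qed (simp_all add: M_eval_explicit poly_subst_M_const poly_subst_M_var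
      is_ring_hom_seq_const is_ring_hom_ident mp_eval_def seq_const_def seq_act_def)
  then show ?thesis by (rule fun_cong)
qed

lemma M_eval_M_act: "M_eval (M_act m f) x = seq_act m (M_eval f x)"
  using M_eval_hom[of x] by (simp add: is_M_eval_hom_def is_M_ring_hom_def)

theorem theorem3p1:
  fixes F :: "('m::monoid_mult, 'n::finite, 'k::alg_closed_field) M_poly set"
  assumes "(UNIV :: 'm set) \<prec> (UNIV :: 'k set)"
  shows "vanishing_ideal (zero_locus F) = radical (ideal_generated (\<Union>m. M_act m ` F))"
proof
  let ?I = "ideal_generated (\<Union>m. M_act m ` F)"
  show "radical ?I \<subseteq> vanishing_ideal (zero_locus F)"
  proof
    fix f assume "f \<in> radical ?I"
    then obtain r where r: "f ^ r \<in> ?I" by (auto simp: radical_def)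
    have "M_eval f x = 0" if x: "x \<in> zero_locus F" for x
    proof -
      have hom: "is_ring_hom (\<lambda>f. M_eval f x)"
        using M_eval_hom[of x] by (simp add: is_M_eval_hom_def is_M_ring_hom_def)
      note h = ring_hom_simps[OF hom]
      have "is_ideal {p. M_eval p x = 0}" by (simp add: is_ideal_def h)
      \<comment> \<open>A shift of the zero sequence is zero, so the translates of \<open>F\<close>
        vanish at \<open>x\<close> as well.\<close>
      moreover have "(\<Union>m. M_act m ` F) \<subseteq> {p. M_eval p x = 0}"
        using x by (auto simp: zero_locus_def M_eval_M_act seq_act_def zero_fun_def)
      ultimately have "M_eval (f ^ r) x = 0" using ideal_generated_minimal r by blast
      then have "M_eval (f ^ r) x m = 0" for m by simp
      then have "M_eval f x m ^ r = 0" for m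
        by (simp add: M_eval_at ring_hom_simps(7)[OF is_ring_hom_mp_eval])
      then show ?thesis by (simp add: fun_eq_iff)
    qed
    then show "f \<in> vanishing_ideal (zero_locus F)" by (simp add: vanishing_ideal_def)
  qed
  show "vanishing_ideal (zero_locus F) \<subseteq> radical ?I"
  proof (rule subsetI, rule ccontr)
    fix f assume f: "f \<in> vanishing_ideal (zero_locus F)" and nf: "f \<notin> radical ?I"
    \<comment> \<open>The radical allows positive exponents only, whereas exponent 0 must be
      excluded too; hence the passage to \<open>Suc r\<close>.\<close>
    have powers: "f ^ r \<notin> ?I" for r
    proof
      assume "f ^ r \<in> ?I"
      then have "f ^ Suc r \<in> ?I" using ideal_mult_left[OF is_ideal_ideal_generated] by simp
      then show False using nf by (auto simp: radical_def)
    qed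
    have size: "finite (UNIV :: ('m \<times> 'n) set) \<or> (UNIV :: ('m \<times> 'n) set) \<prec> (UNIV :: 'k set)"
    proof (cases "finite (UNIV :: 'm set)")
      case True
      then show ?thesis by (simp add: finite_prod)
    next
      case False
      \<comment> \<open>For infinite \<open>M\<close>, finitely many variables give no more
        indeterminates than elements of \<open>M\<close>.\<close>
      have "(UNIV :: 'n set) \<lesssim> (UNIV :: 'm set)" using False by (simp add: finite_lepoll_infinite)
      then have "(UNIV :: 'm set) \<times> (UNIV :: 'n set) \<lesssim> (UNIV :: 'm set) \<times> (UNIV :: 'm set)"
        by (intro times_lepoll_mono lepoll_refl)
      also have "\<dots> \<lesssim> (UNIV :: 'm set)" by (rule lepoll_times_self[OF False])
      finally have "(UNIV :: ('m \<times> 'n) set) \<prec> (UNIV :: 'k set)"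
        using assms by (simp add: lesspoll_trans1)
      then show ?thesis ..
    qed
    obtain \<xi> where \<xi>: "mp_eval \<xi> f \<noteq> 0" "\<forall>g\<in>?I. mp_eval \<xi> g = 0"
      using nullstellensatz_point[OF is_ideal_ideal_generated powers size] by blast
    \<comment> \<open>The coordinates of \<open>\<xi>\<close> arranged as sequences, so that
      evaluation at \<open>\<xi>\<close> reads off the entry at \<open>1\<close>.\<close>
    define x where "x = (\<lambda>i m. \<xi> (m, i))"
    have at_one: "mp_eval \<xi> g = M_eval g x 1" for g by (simp add: M_eval_at x_def)
    have "M_eval g x m = 0" if "g \<in> F" for g m
    proof -
      \<comment> \<open>The action moves entry \<open>m\<close> to position \<open>1\<close>, where
        the vanishing of the translates of \<open>g\<close> at \<open>\<xi>\<close> applies.\<close>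
      have "M_act m g \<in> (\<Union>m. M_act m ` F)" using that by blast
      then have "M_act m g \<in> ?I" by (rule subsetD[OF subset_ideal_generated])
      then have "M_eval (M_act m g) x 1 = 0" using \<xi>(2) by (simp flip: at_one)
      then show ?thesis by (simp add: M_eval_M_act seq_act_def)
    qed
    then have "x \<in> zero_locus F" by (auto simp: zero_locus_def fun_eq_iff)
    then show False using f \<xi>(1) by (simp add: at_one vanishing_ideal_def)
  qed
qed

end
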